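(* Fix $d_1,d_2\in\mathbb{C}$, $n\in\mathbb{N}\cup\{0\}$ and $\alpha\in\mathbb{C}\setminus(2\mathbb{Z})$. The solution $$u_n(x,\alpha)=-\frac{\Delta_{n+1}(x,\alpha-2)\Delta_n(x,\alpha)}{\Delta_{n+1}(x,\alpha)\Delta_n(x,\alpha-2)}$$ of the Painlevé III equation $$u_n''=\frac{(u_n')^2}{u_n}-\frac{u_n'}{x}+\frac{(\alpha+2n)u_n^2+(-\alpha+2+2n)}{x}+u_n^3-\frac{1}{u_n}$$ has the following asymptotics as $x\to0$, $-\pi<\arg(x)<\pi$. (1) If $d_2\neq0$ and, in addition, either $\mathrm{Re}(\alpha)>2n+2$ or $d_1\sin\left(\frac{\pi\alpha}{2}\right)+d_2\cos\left(\frac{\pi\alpha}{2}\right)=0$, then $$u_n(x,\alpha)\sim\left(\frac{2}{2n+2-\alpha}\right)\frac{x}{2}.$$ (2) If $d_2\neq0$, $d_1\sin\left(\frac{\pi\alpha}{2}\right)+d_2\cos\left(\frac{\pi\alpha}{2}\right)\neq0$, and $2n-4j<\mathrm{Re}(\alpha)<2n-4j+2$ for some $j\in\{0,1,\dots,n\}$, then $$u_n(x,\alpha)\sim(-1)^n\left(\frac{d_1}{d_2}\sin\left(\frac{\pi\alpha}{2}\right)+\cos\left(\frac{\pi\alpha}{2}\right)\right)\left(\frac{\Gamma(-\frac{\alpha}{2}+n-2j+1)}{\Gamma(\frac{\alpha}{2}-n+2j)}\right)^2\frac{\Gamma(j+\frac{\alpha}{2})\Gamma(j+1)}{\Gamma(-\frac{\alpha}{2}+n-j+1)\Gamma(n-j+1)}\left(\frac{x}{2}\right)^{\alpha-2n+4j-1}.$$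 (3) If $d_2\neq0$, $d_1\sin\left(\frac{\pi\alpha}{2}\right)+d_2\cos\left(\frac{\pi\alpha}{2}\right)\neq0$, and $2n-4j-2<\mathrm{Re}(\alpha)<2n-4j$ for some $j\in\{0,1,\dots,n-1\}$, then $$u_n(x,\alpha)\sim(-1)^n\left(\frac{d_1}{d_2}\sin\left(\frac{\pi\alpha}{2}\right)+\cos\left(\frac{\pi\alpha}{2}\right)\right)^{-1}\left(\frac{\Gamma(\frac{\alpha}{2}-n+2j+1)}{\Gamma(-\frac{\alpha}{2}+n-2j)}\right)^2\frac{\Gamma(-\frac{\alpha}{2}+n-j+1)\Gamma(n-j)}{\Gamma(j+\frac{\alpha}{2}+1)\Gamma(j+1)}\left(\frac{x}{2}\right)^{-\alpha+2n-4j-1}.$$ (4) If $d_1\sin\left(\frac{\pi\alpha}{2}\right)+d_2\cos\left(\frac{\pi\alpha}{2}\right)\neq0$ and, in addition, either $\mathrm{Re}(\alpha)<-2n$ or $d_2=0$, then $$u_n(x,\alpha)\sim\left(-\frac{\alpha}{2}-n\right)\left(\frac{x}{2}\right)^{-1}.$$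
   Context: $J_\nu(x)$ and $Y_\nu(x)$ are the Bessel functions of the first and second kind (principal branches), and $\mathcal{C}_\nu(x)=d_1J_\nu(x)+d_2Y_\nu(x)$ with $d_1,d_2$ independent of $\nu$. For $n\in\mathbb{N}=\{1,2,\dots\}$, $\Delta_n(x,\alpha)=\det\left(\left\{\mathcal{C}_{\frac{\alpha}{2}-j+k}(x)\right\}_{j,k=0}^{n-1}\right)$, and $\Delta_0(x,\alpha)=1$. $\Gamma$ is the Gamma function. Powers of $x$ are principal branches. $f\sim g$ means $f=g\,(1+o(1))$. *)

theory Defs
  imports
    "HOL-Analysis.Analysis"
    "HOL-Library.Landau_Symbols"
    "Jordan_Normal_Form.Determinant"
begin

text \<open>
  All Bessel functions are the principal branches, given by the principal power \<^const>\<open>powr\<close>; they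
  are only meant to be used at nonzero arguments, since \<open>0 powr \<nu> = 0\<close> even for \<open>\<nu> = 0\<close>.
  As \<^const>\<open>rGamma\<close> is the entire function \<open>1/\<Gamma>\<close>, the series needs no restriction on \<open>\<nu>\<close>.
\<close>

definition Bessel_J :: "complex \<Rightarrow> complex \<Rightarrow> complex" where
  "Bessel_J \<nu> x =
     (x / 2) powr \<nu> * (\<Sum>k. (-1) ^ k * rGamma (\<nu> + of_nat k + 1) / fact k * (x / 2) ^ (2 * k))"

definition Bessel_Y :: "complex \<Rightarrow> complex \<Rightarrow> complex" where
  "Bessel_Y \<nu> x =
     (let Y = (\<lambda>\<mu>. (Bessel_J \<mu> x * cos (of_real pi * \<mu>) - Bessel_J (- \<mu>) x) / sin (of_real pi * \<mu>))
      in if \<nu> \<in> \<int> then Lim (at \<nu>) Y else Y \<nu>)"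

definition Bessel_C :: "complex \<Rightarrow> complex \<Rightarrow> complex \<Rightarrow> complex \<Rightarrow> complex" where
  "Bessel_C d1 d2 \<nu> x = d1 * Bessel_J \<nu> x + d2 * Bessel_Y \<nu> x"

text \<open>
  For \<open>n = 0\<close> this is the determinant of the empty matrix, which is \<open>1\<close>.
  The qualified name avoids \<open>Determinants.det\<close> of \<open>HOL-Analysis\<close>, whose dimension is a type.
\<close>

definition Bessel_Delta :: "complex \<Rightarrow> complex \<Rightarrow> nat \<Rightarrow> complex \<Rightarrow> complex \<Rightarrow> complex" where
  "Bessel_Delta d1 d2 n x \<alpha> =
     Determinant.det (Matrix.mat n n (\<lambda>(j, k). Bessel_C d1 d2 (\<alpha> / 2 - of_nat j + of_nat k) x))"

lemma Bessel_Delta_0: "Bessel_Delta d1 d2 0 x \<alpha> = 1"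
  unfolding Bessel_Delta_def by (rule det_dim_zero) simp

definition Bessel_u :: "complex \<Rightarrow> complex \<Rightarrow> nat \<Rightarrow> complex \<Rightarrow> complex \<Rightarrow> complex" where
  "Bessel_u d1 d2 n \<alpha> x =
     - (Bessel_Delta d1 d2 (n + 1) x (\<alpha> - 2) * Bessel_Delta d1 d2 n x \<alpha>) /
       (Bessel_Delta d1 d2 (n + 1) x \<alpha> * Bessel_Delta d1 d2 n x (\<alpha> - 2))"

definition slit_plane :: "complex set" where
  "slit_plane = {x. x \<noteq> 0 \<and> - pi < Arg x \<and> Arg x < pi}"

text \<open>
  The Painleve III equation
  \<open>u'' = (u')\<^sup>2/u - u'/x + (a u\<^sup>2 + b)/x + u\<^sup>3 - 1/u\<close>.
  It is imposed at the points where \<open>u\<close> is finite and nonzero: its right-hand side is singular at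
  the zeros of \<open>u\<close>, and by the convention \<open>z / 0 = 0\<close> a quotient of holomorphic functions such as
  \<open>Bessel_u\<close> also takes the value \<open>0\<close> wherever its denominator vanishes.
\<close>

definition solves_Painleve_III ::
    "complex \<Rightarrow> complex \<Rightarrow> (complex \<Rightarrow> complex) \<Rightarrow> complex set \<Rightarrow> bool" where
  "solves_Painleve_III a b u S \<longleftrightarrow>
     (\<forall>x\<in>S. u x \<noteq> 0 \<longrightarrow>
        u analytic_on {x} \<and>
        deriv (deriv u) x =
          (deriv u x)\<^sup>2 / u x - deriv u x / x + (a * (u x)\<^sup>2 + b) / x + (u x) ^ 3 - 1 / u x)"

end

theory Submission
  imports Defs "Jordan_Normal_Form.Char_Poly" "HOL-Complex_Analysis.Complex_Analysis"
begin

text \<open>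
  Put $a = \alpha/2$. Since $a$ is not an integer, $\mathcal{C}_{a+m} = A J_{a+m} + (-1)^m B J_{-a-m}$ with $A$, $B$
  independent of $m$, and $A = 0$, $B = 0$ are the exceptional cases of the theorem. Let $T_n^m$ be the
  Toeplitz determinant with entries $\mathcal{C}_{a+m-j+k}$. The Desnanot--Jacobi identity is a Toda equation for
  $T_n^m$, and together with the Bessel recurrences it yields, by induction on $n$, bilinear relations
  between neighbouring determinants and their derivatives. These hold where no determinant vanishes,
  hence everywhere by analytic continuation. They give a first-order system for $u_n$ and
  $W_n = x T_{n+2}^0 T_n^{-1} / (T_{n+1}^0 T_{n+1}^{-1})$, hence Painleve III, and the recursion
  $u_n u_{n+1} = (W_n + 2n + 2)/W_n$, $W_n + W_{n+1} = -x(u_{n+1} + 1/u_{n+1}) - 2a - 2n - 2$.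

  As $x \to 0$, the Toda equation determines $T_n^m$ to leading order if $\mathrm{Re}\,a$ is large. This gives case (1)
  and the first strip of case (2). The symmetry $u_n \mapsto -1/u_n$, $a \mapsto 1 - a$ turns these into case (4)
  and the last strip of case (2). On a fixed strip of width one, $W_n$ has a finite nonzero limit, and the
  recursion carries the leading term of $u_n$ from the smallest such $n$ to all larger ones without
  cancellation.
\<close>

section \<open>Determinants and the Desnanot--Jacobi identity\<close>

text \<open>Up to reflection, leading terms of the determinants are needed only where at most one
  factor $J_{a+m}$ contributes; in the intermediate strips the determinants are never expanded. What
  replaces such an expansion is $W_n$. On the strip $i - j < Re a < i - j + 1$ the exponent of $u_n$
  has real part strictly between -1 and 1, so $x u_n$ and $x / u_n$ tend to 0 and the limits $w_n$
  of $W_n$ obey the linear rule $w_{n+1} = - w_n - 2a - 2n - 2$. They alternate between $-2(a + j)$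
  at $n = i + j$ and $-2(i + 1)$ at $n = i + j + 1$, and correspondingly $w_n + 2n + 2$ is $2(i + 1
  - a)$ or $2(j + 1)$. As $a$ is not an integer, none of these vanishes, so $u_n u_{n+1}$ has a
  finite nonzero limit. The analytic continuation presupposes that no determinant vanishes
  identically. The same identities yield this by strong induction, since they need only one point at
  which all smaller determinants are nonzero.\<close>

definition fdet :: "nat \<Rightarrow> (nat \<Rightarrow> nat \<Rightarrow> 'a::comm_ring_1) \<Rightarrow> 'a" where
  "fdet n f = Determinant.det (Matrix.mat n n (\<lambda>(i, j). f i j))"

lemma fdet_cong:
  assumes "\<And>i j. i < n \<Longrightarrow> j < n \<Longrightarrow> f i j = g i j"
  shows "fdet n f = fdet n g"
  unfolding fdet_def using assms by (intro arg_cong[where f = Determinant.det] eq_matI) auto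

lemma fdet_0 [simp]: "fdet 0 f = 1"
  unfolding fdet_def by (rule det_dim_zero) simp

lemma fdet_1 [simp]: "fdet (Suc 0) f = f 0 0"
  unfolding fdet_def by (subst det_single) auto

lemma fdet_transpose: "fdet n (\<lambda>i j. f j i) = fdet n f"
proof -
  have "Matrix.mat n n (\<lambda>(i, j). f j i) = (Matrix.mat n n (\<lambda>(i, j). f i j))\<^sup>T"
    by (intro eq_matI) auto
  thus ?thesis unfolding fdet_def by (simp add: det_transpose[of _ n])
qed

lemma fdet_permutations:
  "fdet n f = (\<Sum>p\<in>{p. p permutes {0..<n}}. signof p * (\<Prod>i=0..<n. f i (p i)))"
  unfolding fdet_def
  by (subst det_def'[of _ n])
     (auto intro!: sum.cong prod.cong arg_cong2[where f = "(*)"] simp: permutes_in_image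
       dest: permutes_in_image)

lemma fdet_scale_rows:
  "fdet n (\<lambda>i j. r i * f i j) = (\<Prod>i<n. r i) * fdet n f" for r :: "nat \<Rightarrow> 'a::comm_ring_1"
  unfolding fdet_permutations prod.distrib sum_distrib_left
  by (intro sum.cong) (simp_all add: mult_ac atLeast0LessThan)

lemma fdet_scale_columns:
  "fdet n (\<lambda>i j. r j * f i j) = (\<Prod>i<n. r i) * fdet n f" for r :: "nat \<Rightarrow> 'a::comm_ring_1"
  using fdet_scale_rows[of n r "\<lambda>i j. f j i"] fdet_transpose[of n "\<lambda>i j. r j * f i j"]
    fdet_transpose[of n f] by simp

lemma cofactor_mat:
  assumes "k < Suc n" "l < Suc n"
  shows "cofactor (Matrix.mat (Suc n) (Suc n) (\<lambda>(i, j). f i j)) k l =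
    (-1) ^ (k + l) * fdet n (\<lambda>i j. f (if i < k then i else Suc i) (if j < l then j else Suc j))"
  unfolding cofactor_def fdet_def mat_delete_def using assms
  by (intro arg_cong2[where f = "(*)"] refl arg_cong[where f = Determinant.det] eq_matI)
     (auto simp: not_less)

lemma fdet_expand_singleton_column:
  assumes "k < Suc n" "l < Suc n" "\<And>i. i < Suc n \<Longrightarrow> i \<noteq> k \<Longrightarrow> f i l = 0"
  shows "fdet (Suc n) f = f k l * (-1) ^ (k + l) *
    fdet n (\<lambda>i j. f (if i < k then i else Suc i) (if j < l then j else Suc j))"
proof -
  let ?M = "Matrix.mat (Suc n) (Suc n) (\<lambda>(i, j). f i j)"
  have "fdet (Suc n) f = (\<Sum>i<Suc n. ?M $$ (i, l) * cofactor ?M i l)"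
    unfolding fdet_def by (rule laplace_expansion_column) (use assms in auto)
  also have "\<dots> = (\<Sum>i<Suc n. if i = k then f k l * cofactor ?M k l else 0)"
    using assms by (intro sum.cong) auto
  also have "\<dots> = f k l * cofactor ?M k l"
    using assms by (subst sum.delta) auto
  finally show ?thesis
    using assms by (simp add: cofactor_mat mult.assoc)
qed

text \<open>Determinant of the auxiliary factor in the next proof. Expanding along an interior unit
  column leaves a matrix of the same shape one size smaller, until a 2 by 2 determinant
  remains.\<close>

lemma fdet_identity_outer_columns:
  fixes p q :: "nat \<Rightarrow> 'a::comm_ring_1"
  shows "fdet (Suc (Suc n))
      (\<lambda>i j. if j = 0 then p i else if j = Suc n then q i else if i = j then 1 else 0) =
    p 0 * q (Suc n) - p (Suc n) * q 0"
proof (induction n arbitrary: p q)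
  case 0
  define f where "f = (\<lambda>i j. if j = 0 then p i else if j = Suc 0 then q i else if i = j then 1 else (0::'a))"
  let ?M = "Matrix.mat (Suc (Suc 0)) (Suc (Suc 0)) (\<lambda>(i, j). f i j)"
  have "fdet (Suc (Suc 0)) f = (\<Sum>i<Suc (Suc 0). ?M $$ (i, 0) * cofactor ?M i 0)"
    unfolding fdet_def by (rule laplace_expansion_column) auto
  also have "\<dots> = p 0 * q 1 - p 1 * q 0"
    by (simp add: cofactor_mat f_def)
  finally show ?case by (simp add: f_def)
next
  case (Suc n)
  let ?s = "\<lambda>i. if i < 1 then i else Suc i"
  have "fdet (Suc (Suc (Suc n)))
      (\<lambda>i j. if j = 0 then p i else if j = Suc (Suc n) then q i else if i = j then 1 else 0) =
    fdet (Suc (Suc n)) (\<lambda>i j. if ?s j = 0 then p (?s i) else if ?s j = Suc (Suc n) then q (?s i)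
      else if ?s i = ?s j then 1 else 0)"
    by (subst fdet_expand_singleton_column[where k = 1 and l = 1]) auto
  also have "\<dots> = fdet (Suc (Suc n)) (\<lambda>i j. if j = 0 then p (?s i) else if j = Suc n then q (?s i)
      else if i = j then 1 else 0)"
    by (intro fdet_cong) auto
  also have "\<dots> = p (?s 0) * q (?s (Suc n)) - p (?s (Suc n)) * q (?s 0)"
    by (rule Suc.IH)
  finally show ?case by simp
qed

text \<open>Jacobi's argument. Let \<open>P\<close> be the identity matrix with its first and last
  columns replaced by those of the adjugate of \<open>M\<close>. Then \<open>M * P\<close> keeps the
  interior columns of \<open>M\<close>, while its outer columns are \<open>d\<close> times unit
  vectors. Comparing determinants gives \<open>d\<close> times a 2 by 2 minor of the adjugate on one
  side and \<open>d\<close> squared times the inner minor on the other; one factor \<open>d\<close>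
  is cancelled.\<close>

lemma desnanot_jacobi_nonzero:
  fixes f :: "nat \<Rightarrow> nat \<Rightarrow> 'a::idom"
  assumes nz: "fdet (Suc (Suc n)) f \<noteq> 0"
  shows "fdet (Suc (Suc n)) f * fdet n (\<lambda>i j. f (Suc i) (Suc j)) =
    fdet (Suc n) f * fdet (Suc n) (\<lambda>i j. f (Suc i) (Suc j)) -
    fdet (Suc n) (\<lambda>i j. f (Suc i) j) * fdet (Suc n) (\<lambda>i j. f i (Suc j))"
proof -
  define N where "N = Suc (Suc n)"
  define M where "M = Matrix.mat N N (\<lambda>(i, j). f i j)"
  define g where "g = (\<lambda>i j. if j = 0 then cofactor M 0 i else if j = Suc n then cofactor M (Suc n) i
      else if i = j then 1 else 0)"
  define P where "P = Matrix.mat N N (\<lambda>(i, j). g i j)"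
  define d where "d = Determinant.det M"
  define h where "h = (\<lambda>i j. if j = 0 then (if i = 0 then d else 0)
      else if j = Suc n then (if i = Suc n then d else 0) else f i j)"
  have MC [simp]: "M \<in> carrier_mat N N" and PC [simp]: "P \<in> carrier_mat N N"
    by (auto simp: M_def P_def)
  have adj: "(\<Sum>k<N. f i k * cofactor M l k) = (if i = l then d else 0)" if "i < N" "l < N" for i l
  proof -
    have "(M * adj_mat M) $$ (i, l) = (\<Sum>k<N. f i k * cofactor M l k)"
      using that unfolding times_mat_def scalar_prod_def adj_mat_def
      by (auto simp: M_def intro!: sum.cong)
    also have "(M * adj_mat M) $$ (i, l) = (if i = l then d else 0)"
      using that by (simp add: adj_mat(2)[OF MC] d_def)
    finally show ?thesis by simp
  qed
  have "M * P = Matrix.mat N N (\<lambda>(i, j). h i j)"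
  proof (rule eq_matI)
    fix i j assume "i < dim_row (Matrix.mat N N (\<lambda>(i, j). h i j))"
      and "j < dim_col (Matrix.mat N N (\<lambda>(i, j). h i j))"
    hence ij: "i < N" "j < N" by auto
    have "(M * P) $$ (i, j) = (\<Sum>k<N. f i k * g k j)"
      using ij unfolding times_mat_def scalar_prod_def by (auto simp: M_def P_def intro!: sum.cong)
    also have "\<dots> = h i j"
    proof -
      consider "j = 0" | "j = Suc n" | "j \<noteq> 0" "j \<noteq> Suc n" by blast
      thus ?thesis
      proof cases
        case 1 thus ?thesis using ij adj[of i 0] by (simp add: g_def h_def N_def)
      next
        case 2 thus ?thesis using ij adj[of i "Suc n"] by (simp add: g_def h_def N_def)
      next
        case 3
        hence "(\<Sum>k<N. f i k * g k j) = (\<Sum>k<N. if k = j then f i j else 0)"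
          by (intro sum.cong) (auto simp: g_def)
        thus ?thesis using 3 ij by (simp add: h_def)
      qed
    qed
    finally show "(M * P) $$ (i, j) = Matrix.mat N N (\<lambda>(i, j). h i j) $$ (i, j)"
      using ij by simp
  qed (auto simp: M_def P_def)
  hence "d * fdet N g = fdet N h"
    using det_mult[OF MC PC] by (simp add: fdet_def d_def P_def)
  moreover have "fdet N g = g 0 0 * g (Suc n) (Suc n) - g (Suc n) 0 * g 0 (Suc n)"
    unfolding N_def g_def by (subst fdet_identity_outer_columns) auto
  moreover have "fdet N h = d * (d * fdet n (\<lambda>i j. f (Suc i) (Suc j)))"
  proof -
    have "fdet N h = d * fdet (Suc n) (\<lambda>i j. h (Suc i) (Suc j))"
      unfolding N_def by (subst fdet_expand_singleton_column[where k = 0 and l = 0]) (auto simp: h_def)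
    also have "fdet (Suc n) (\<lambda>i j. h (Suc i) (Suc j)) = d * fdet n (\<lambda>i j. f (Suc i) (Suc j))"
    proof -
      have "fdet (Suc n) (\<lambda>i j. h (Suc i) (Suc j)) = d * (-1) ^ (n + n) *
          fdet n (\<lambda>i j. h (Suc (if i < n then i else Suc i)) (Suc (if j < n then j else Suc j)))"
        by (subst fdet_expand_singleton_column[where k = n and l = n]) (auto simp: h_def)
      also have "fdet n (\<lambda>i j. h (Suc (if i < n then i else Suc i)) (Suc (if j < n then j else Suc j))) =
          fdet n (\<lambda>i j. f (Suc i) (Suc j))"
        by (rule fdet_cong) (auto simp: h_def)
      finally show ?thesis by simp
    qed
    finally show ?thesis .
  qed
  moreover have "d \<noteq> 0" using nz by (simp add: d_def fdet_def M_def N_def)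
  ultimately have "g 0 0 * g (Suc n) (Suc n) - g (Suc n) 0 * g 0 (Suc n) =
      d * fdet n (\<lambda>i j. f (Suc i) (Suc j))"
    by (metis mult_left_cancel)
  moreover have "g 0 0 = fdet (Suc n) (\<lambda>i j. f (Suc i) (Suc j))"
    unfolding g_def M_def N_def by (subst (1) cofactor_mat) auto
  moreover have "g (Suc n) (Suc n) = fdet (Suc n) f"
    unfolding g_def M_def N_def
    by (simp add: cofactor_mat) (rule fdet_cong; simp)
  moreover have "g (Suc n) 0 = (-1) ^ Suc n * fdet (Suc n) (\<lambda>i j. f (Suc i) j)"
    unfolding g_def M_def N_def
    by (simp add: cofactor_mat) (rule fdet_cong; simp)
  moreover have "g 0 (Suc n) = (-1) ^ Suc n * fdet (Suc n) (\<lambda>i j. f i (Suc j))"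
    unfolding g_def M_def N_def
    by (simp add: cofactor_mat) (rule fdet_cong; simp)
  moreover have "d = fdet (Suc (Suc n)) f"
    by (simp add: d_def fdet_def M_def N_def)
  moreover have "(s * p) * (s * q) = p * q" if "s * s = 1" for s p q :: 'a
    using that by (metis mult.assoc mult.left_commute mult_1)
  moreover have "(-1) ^ Suc n * (-1) ^ Suc n = (1::'a)"
    by (simp flip: power_mult_distrib)
  ultimately show ?thesis
    by (simp only: mult.commute[of "fdet (Suc n) f"])
qed

text \<open>
  A singular matrix $F$ is perturbed to $F + X$ over the polynomial ring, whose determinant is monic;
  the identity is then evaluated at $X = 0$.
\<close>

theorem desnanot_jacobi:
  fixes f :: "nat \<Rightarrow> nat \<Rightarrow> 'a::idom"
  shows "fdet (Suc (Suc n)) f * fdet n (\<lambda>i j. f (Suc i) (Suc j)) =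
    fdet (Suc n) f * fdet (Suc n) (\<lambda>i j. f (Suc i) (Suc j)) -
    fdet (Suc n) (\<lambda>i j. f (Suc i) j) * fdet (Suc n) (\<lambda>i j. f i (Suc j))"
proof -
  define g where "g = (\<lambda>i j. [:f i j, if i = j then 1 else 0:])"
  define M where "M = Matrix.mat (Suc (Suc n)) (Suc (Suc n)) (\<lambda>(i, j). - f i j)"
  have eval: "poly (fdet m (\<lambda>i j. g (r i) (s j))) 0 = fdet m (\<lambda>i j. f (r i) (s j))"
    for m and r s :: "nat \<Rightarrow> nat"
    unfolding fdet_def by (rule poly_det_cong[of _ m]) (auto simp: g_def)
  have "fdet (Suc (Suc n)) g = char_poly M"
    unfolding fdet_def char_poly_def char_poly_matrix_def M_def
    by (intro arg_cong[where f = Determinant.det] eq_matI) (auto simp: g_def)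
  moreover have "char_poly M \<noteq> 0"
    using degree_monic_char_poly[of M "Suc (Suc n)"] by (auto simp: M_def)
  ultimately have "fdet (Suc (Suc n)) g \<noteq> 0" by simp
  from arg_cong[OF desnanot_jacobi_nonzero[OF this], of "\<lambda>p. poly p 0"]
  show ?thesis
    using eval[where r = "\<lambda>i. i" and s = "\<lambda>i. i"] eval[where r = Suc and s = "\<lambda>i. i"]
      eval[where r = "\<lambda>i. i" and s = Suc] eval[where r = Suc and s = Suc]
    by simp
qed

section \<open>Bilinear identities of a Toda lattice with Bessel seed\<close>

text \<open>
  \<open>T n m\<close> and \<open>T' n m\<close> are the values at one point \<open>x\<close> of the $n \times n$ Toeplitz determinant with
  entries $\mathcal{C}_{a+m-j+k}$ and of its derivative. All identities below are obtained from the Toda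
  equation by induction on \<open>n\<close>; each step divides by a few of the \<open>T n m\<close>.
\<close>

locale bessel_toda =
  fixes T T' :: "nat \<Rightarrow> int \<Rightarrow> 'a::field_char_0" and x a :: 'a
  assumes x_nonzero: "x \<noteq> 0"
    and T_0: "T 0 m = 1" and T'_0: "T' 0 m = 0"
    and toda: "T (Suc (Suc n)) m * T n m =
      (T (Suc n) m)\<^sup>2 - T (Suc n) (m + 1) * T (Suc n) (m - 1)"
    and toda_deriv: "T' (Suc (Suc n)) m * T n m + T (Suc (Suc n)) m * T' n m =
      2 * T (Suc n) m * T' (Suc n) m - T' (Suc n) (m + 1) * T (Suc n) (m - 1)
        - T (Suc n) (m + 1) * T' (Suc n) (m - 1)"
    and recurrence: "x * (T 1 (m - 1) + T 1 (m + 1)) = 2 * (a + of_int m) * T 1 m"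
    and deriv: "x * T' 1 m = x * T 1 (m - 1) - (a + of_int m) * T 1 m"
begin

text \<open>Of the four families, \<open>shift1\<close> at level 0 is the three-term recurrence of
  the seed and \<open>wronskian_n\<close> at level 0 is its derivative rule. The other two compare
  neighbours in the direction of \<open>m\<close>, and they are what lets the induction on
  \<open>n\<close> close.\<close>

definition shift2 where
  "shift2 n m \<longleftrightarrow> x * (T (Suc (Suc n)) m * T n (m - 1) - T (Suc (Suc n)) (m - 1) * T n m) =
     - 2 * of_nat (Suc n) * T (Suc n) m * T (Suc n) (m - 1)"

definition shift1 where
  "shift1 n m \<longleftrightarrow> x * (T (Suc n) (m - 1) * T n (m + 1) + T (Suc n) (m + 1) * T n (m - 1)) =
     2 * (a + of_int m) * T (Suc n) m * T n m"

definition wronskian_n where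
  "wronskian_n n m \<longleftrightarrow> x * (T' (Suc n) m * T n m - T (Suc n) m * T' n m) =
     x * T (Suc n) (m - 1) * T n (m + 1) - (a + of_int m) * T (Suc n) m * T n m"

definition wronskian_m where
  "wronskian_m n m \<longleftrightarrow>
     x * (T' (Suc n) (m - 1) * T (Suc n) m - T (Suc n) (m - 1) * T' (Suc n) m) =
     - x * T (Suc (Suc n)) m * T n (m - 1) - of_nat (Suc n) * T (Suc n) m * T (Suc n) (m - 1)"

lemma T_2: "T (Suc (Suc 0)) m = (T 1 m)\<^sup>2 - T 1 (m + 1) * T 1 (m - 1)"
  using toda[of 0 m] by (simp add: T_0)

lemma shift1_0: "shift1 0 m"
  using recurrence[of m] by (simp add: shift1_def T_0 algebra_simps)

lemma shift2_0: "shift2 0 m"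
proof -
  have r1: "x * T 1 (m - 1) + x * T 1 (m + 1) - 2 * (a + of_int m) * T 1 m = 0"
    using recurrence[of m] by (simp add: algebra_simps)
  have r2: "x * T 1 (m - 1 - 1) + x * T 1 m - 2 * (a + of_int m - 1) * T 1 (m - 1) = 0"
    using recurrence[of "m - 1"] by (simp add: algebra_simps)
  have "x * (T (Suc (Suc 0)) m - T (Suc (Suc 0)) (m - 1)) + 2 * T 1 m * T 1 (m - 1) =
     - T 1 (m - 1) * (x * T 1 (m - 1) + x * T 1 (m + 1) - 2 * (a + of_int m) * T 1 m)
     + T 1 m * (x * T 1 (m - 1 - 1) + x * T 1 m - 2 * (a + of_int m - 1) * T 1 (m - 1))"
    unfolding T_2 by (simp add: algebra_simps power2_eq_square)
  thus ?thesis unfolding r1 r2 shift2_def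
    by (simp add: T_0 eq_neg_iff_add_eq_0)
qed

text \<open>After multiplication by \<open>T n m\<close> the claim is a combination of two instances
  of \<open>shift2\<close> and one of \<open>shift1\<close>. The weights \<open>- q1\<close> and
  \<open>qm\<close> make the two terms with factor \<open>N\<close> cancel.\<close>

lemma shift1_Suc:
  assumes "T n m \<noteq> 0" "shift2 n m" "shift2 n (m + 1)" "shift1 n m"
  shows "shift1 (Suc n) m"
proof -
  define p p1 pm where "p = T n m" "p1 = T n (m + 1)" "pm = T n (m - 1)"
  define q q1 qm where "q = T (Suc n) m" "q1 = T (Suc n) (m + 1)" "qm = T (Suc n) (m - 1)"
  define r r1 rm where "r = T (Suc (Suc n)) m" "r1 = T (Suc (Suc n)) (m + 1)" "rm = T (Suc (Suc n)) (m - 1)"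
  define N :: 'a where "N = of_nat (Suc n)"
  note defs = p_p1_pm_def q_q1_qm_def r_r1_rm_def N_def
  have h1: "x * (r * pm - rm * p) + 2 * N * q * qm = 0"
    using assms(2) by (simp add: shift2_def defs algebra_simps)
  have h2: "x * (r1 * p - r * p1) + 2 * N * q1 * q = 0"
    using assms(3) by (simp add: shift2_def defs algebra_simps)
  have h3: "x * (qm * p1 + q1 * pm) - 2 * (a + of_int m) * q * p = 0"
    using assms(4) by (simp add: shift1_def defs algebra_simps)
  have "p * (x * (rm * q1 + r1 * qm) - 2 * (a + of_int m) * r * q) =
      - q1 * (x * (r * pm - rm * p) + 2 * N * q * qm) + qm * (x * (r1 * p - r * p1) + 2 * N * q1 * q)
      + r * (x * (qm * p1 + q1 * pm) - 2 * (a + of_int m) * q * p)"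
    by (simp add: algebra_simps)
  also have "\<dots> = 0" unfolding h1 h2 h3 by simp
  finally have "x * (rm * q1 + r1 * qm) - 2 * (a + of_int m) * r * q = 0"
    using assms(1) by (simp add: defs)
  thus ?thesis by (simp add: shift1_def defs)
qed

lemma shift2_Suc:
  assumes "T (Suc n) m \<noteq> 0" "T (Suc n) (m - 1) \<noteq> 0"
    and "shift2 n m" "shift1 (Suc n) m" "shift1 (Suc n) (m - 1)"
  shows "shift2 (Suc n) m"
proof -
  define p pm where "p = T n m" "pm = T n (m - 1)"
  define q q1 qm qmm where "q = T (Suc n) m" "q1 = T (Suc n) (m + 1)" "qm = T (Suc n) (m - 1)"
    "qmm = T (Suc n) (m - 1 - 1)"
  define r r1 rm rmm where "r = T (Suc (Suc n)) m" "r1 = T (Suc (Suc n)) (m + 1)"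
    "rm = T (Suc (Suc n)) (m - 1)" "rmm = T (Suc (Suc n)) (m - 1 - 1)"
  define s sm where "s = T (Suc (Suc (Suc n))) m" "sm = T (Suc (Suc (Suc n))) (m - 1)"
  define N :: 'a where "N = of_nat (Suc n)"
  define b where "b = a + of_int m"
  note defs = p_pm_def q_q1_qm_qmm_def r_r1_rm_rmm_def s_sm_def N_def b_def
  have h1: "x * (r * pm - rm * p) + 2 * N * q * qm = 0"
    using assms(3) by (simp add: shift2_def defs algebra_simps)
  have h2: "x * (rm * q1 + r1 * qm) - 2 * b * r * q = 0"
    using assms(4) by (simp add: shift1_def defs algebra_simps)
  have h3: "x * (rmm * q + r * qmm) - 2 * (b - 1) * rm * qm = 0"
    using assms(5) by (simp add: shift1_def defs algebra_simps)
  have h4: "s * q - r\<^sup>2 + r1 * rm = 0"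
    using toda[of "Suc n" m] by (simp add: defs)
  have h5: "sm * qm - rm\<^sup>2 + r * rmm = 0"
    using toda[of "Suc n" "m - 1"] by (simp add: defs)
  have h6: "r * p - q\<^sup>2 + q1 * qm = 0"
    using toda[of n m] by (simp add: defs)
  have h7: "rm * pm - qm\<^sup>2 + q * qmm = 0"
    using toda[of n "m - 1"] by (simp add: defs)
  \<comment> \<open>The factor \<open>q * qm\<close> makes \<open>s\<close> and \<open>sm\<close>
    occur only as \<open>s * q\<close> and \<open>sm * qm\<close>, which the Toda equation one level
    up expresses by level n + 2. The two instances of \<open>shift1\<close> and the Toda equation at
    level n then reduce the rest to \<open>shift2\<close>.\<close>
  have "q * qm * (x * (s * qm - sm * q) + 2 * (N + 1) * r * rm) =
      x * qm\<^sup>2 * (s * q - r\<^sup>2 + r1 * rm) - x * q\<^sup>2 * (sm * qm - rm\<^sup>2 + r * rmm)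
      - qm * rm * (x * (rm * q1 + r1 * qm) - 2 * b * r * q)
      + q * r * (x * (rmm * q + r * qmm) - 2 * (b - 1) * rm * qm)
      - x * r\<^sup>2 * (rm * pm - qm\<^sup>2 + q * qmm) + x * rm\<^sup>2 * (r * p - q\<^sup>2 + q1 * qm)
      + r * rm * (x * (r * pm - rm * p) + 2 * N * q * qm)"
    by (simp add: algebra_simps power2_eq_square)
  also have "\<dots> = 0" unfolding h1 h2 h3 h4 h5 h6 h7 by simp
  finally have "x * (s * qm - sm * q) + 2 * (N + 1) * r * rm = 0"
    using assms(1,2) by (simp add: defs)
  thus ?thesis by (simp add: shift2_def defs algebra_simps eq_neg_iff_add_eq_0)
qed

text \<open>The two families advance alternately: \<open>shift1\<close> reaches the next level
  first, and \<open>shift2\<close> follows from it at both \<open>m\<close> and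
  \<open>m - 1\<close>. Hence all \<open>m\<close> are treated at once.\<close>

lemma shift_identities:
  assumes "\<And>k m. k \<le> n \<Longrightarrow> T k m \<noteq> 0"
  shows "shift2 n m \<and> shift1 n m"
  using assms
proof (induction n arbitrary: m)
  case 0
  show ?case using shift2_0 shift1_0 by blast
next
  case (Suc n)
  have IH: "shift2 n m \<and> shift1 n m" for m
    using Suc.IH Suc.prems by simp
  have "shift1 (Suc n) m" for m
    using shift1_Suc[of n m] IH Suc.prems[of n m] by auto
  thus ?case
    using shift2_Suc[of n m] IH Suc.prems by auto
qed

text \<open>The differentiated Toda equation after \<open>wronskian_m\<close> has eliminated the
  derivatives at \<open>m + 1\<close> and \<open>m - 1\<close>. No division takes place, so the
  relation remains available at a zero of \<open>T (Suc (Suc n)) m\<close>.\<close>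

lemma toda_deriv_combination:
  fixes m :: int
  assumes "wronskian_m n m" "wronskian_m n (m + 1)"
  shows "T (Suc n) m * x * (T' (Suc (Suc n)) m * T n m + T (Suc (Suc n)) m * T' n m) =
    2 * x * T' (Suc n) m * T (Suc (Suc n)) m * T n m
      - x * T (Suc (Suc n)) (m + 1) * T n m * T (Suc n) (m - 1)
      + x * T (Suc n) (m + 1) * T (Suc (Suc n)) m * T n (m - 1)"
proof -
  define p p' pm where "p = T n m" "p' = T' n m" "pm = T n (m - 1)"
  define q q1 qm where "q = T (Suc n) m" "q1 = T (Suc n) (m + 1)" "qm = T (Suc n) (m - 1)"
  define q' q1' qm' where "q' = T' (Suc n) m" "q1' = T' (Suc n) (m + 1)" "qm' = T' (Suc n) (m - 1)"
  define r r1 r' where "r = T (Suc (Suc n)) m" "r1 = T (Suc (Suc n)) (m + 1)" "r' = T' (Suc (Suc n)) m"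
  define N :: 'a where "N = of_nat (Suc n)"
  note defs = p_p'_pm_def q_q1_qm_def q'_q1'_qm'_def r_r1_r'_def N_def
  have h1: "x * (qm' * q - qm * q') + x * r * pm + N * q * qm = 0"
    using assms(1) by (simp add: wronskian_m_def defs algebra_simps)
  have h2: "x * (q' * q1 - q * q1') + x * r1 * p + N * q1 * q = 0"
    using assms(2) by (simp add: wronskian_m_def defs algebra_simps)
  have h3: "r' * p + r * p' - 2 * q * q' + q1' * qm + q1 * qm' = 0"
    using toda_deriv[of n m] by (simp add: defs)
  have h4: "r * p - q\<^sup>2 + q1 * qm = 0"
    using toda[of n m] by (simp add: defs)
  have "q * x * (r' * p + r * p') - (2 * x * q' * r * p - x * r1 * p * qm + x * q1 * r * pm) =
      x * q * (r' * p + r * p' - 2 * q * q' + q1' * qm + q1 * qm')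
      + qm * (x * (q' * q1 - q * q1') + x * r1 * p + N * q1 * q)
      - q1 * (x * (qm' * q - qm * q') + x * r * pm + N * q * qm)
      - 2 * x * q' * (r * p - q\<^sup>2 + q1 * qm)"
    by (simp add: algebra_simps power2_eq_square)
  also have "\<dots> = 0" unfolding h1 h2 h3 h4 by simp
  finally show ?thesis by (simp add: defs)
qed

text \<open>Same mechanism as for \<open>shift1_Suc\<close>: the two instances of
  \<open>shift2\<close> enter with weights \<open>q1\<close> and \<open>- qm\<close>, so that their
  terms in \<open>N\<close> cancel.\<close>

lemma wronskian_n_Suc:
  assumes "T n m \<noteq> 0" "wronskian_n n m" "wronskian_m n m" "wronskian_m n (m + 1)"
    and "shift2 n m" "shift2 n (m + 1)"
  shows "wronskian_n (Suc n) m"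
proof -
  define p p' p1 pm where "p = T n m" "p' = T' n m" "p1 = T n (m + 1)" "pm = T n (m - 1)"
  define q q1 qm q' where "q = T (Suc n) m" "q1 = T (Suc n) (m + 1)" "qm = T (Suc n) (m - 1)"
    "q' = T' (Suc n) m"
  define r r1 rm r' where "r = T (Suc (Suc n)) m" "r1 = T (Suc (Suc n)) (m + 1)"
    "rm = T (Suc (Suc n)) (m - 1)" "r' = T' (Suc (Suc n)) m"
  define N :: 'a where "N = of_nat (Suc n)"
  define b where "b = a + of_int m"
  note defs = p_p'_p1_pm_def q_q1_qm_q'_def r_r1_rm_r'_def N_def b_def
  have h1: "q * x * (r' * p + r * p') - 2 * x * q' * r * p + x * r1 * p * qm - x * q1 * r * pm = 0"
    using toda_deriv_combination[OF assms(3,4)] by (simp add: defs algebra_simps)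
  have h2: "x * (q' * p - q * p') - x * qm * p1 + b * q * p = 0"
    using assms(2) by (simp add: wronskian_n_def defs algebra_simps)
  have h3: "x * (r * pm - rm * p) + 2 * N * q * qm = 0"
    using assms(5) by (simp add: shift2_def defs algebra_simps)
  have h4: "x * (r1 * p - r * p1) + 2 * N * q1 * q = 0"
    using assms(6) by (simp add: shift2_def defs algebra_simps)
  have "p * (x * (r' * q - r * q') - x * rm * q1 + b * r * q) =
      (q * x * (r' * p + r * p') - 2 * x * q' * r * p + x * r1 * p * qm - x * q1 * r * pm)
      + r * (x * (q' * p - q * p') - x * qm * p1 + b * q * p)
      + q1 * (x * (r * pm - rm * p) + 2 * N * q * qm)
      - qm * (x * (r1 * p - r * p1) + 2 * N * q1 * q)"
    by (simp add: algebra_simps)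
  also have "\<dots> = 0" unfolding h1 h2 h3 h4 by simp
  finally have "x * (r' * q - r * q') - x * rm * q1 + b * r * q = 0"
    using assms(1) by (simp add: defs)
  thus ?thesis by (simp add: wronskian_n_def defs algebra_simps)
qed

lemma wronskian_m_Suc:
  assumes "T (Suc n) m \<noteq> 0" "T (Suc n) (m - 1) \<noteq> 0" "wronskian_m n m"
    and "wronskian_n (Suc n) m" "wronskian_n (Suc n) (m - 1)"
    and "shift1 (Suc n) m" "shift1 (Suc n) (m - 1)"
  shows "wronskian_m (Suc n) m"
proof -
  define pm where "pm = T n (m - 1)"
  define q q1 qm qmm where "q = T (Suc n) m" "q1 = T (Suc n) (m + 1)" "qm = T (Suc n) (m - 1)"
    "qmm = T (Suc n) (m - 1 - 1)"
  define q' qm' where "q' = T' (Suc n) m" "qm' = T' (Suc n) (m - 1)"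
  define r r1 rm rmm where "r = T (Suc (Suc n)) m" "r1 = T (Suc (Suc n)) (m + 1)"
    "rm = T (Suc (Suc n)) (m - 1)" "rmm = T (Suc (Suc n)) (m - 1 - 1)"
  define r' rm' where "r' = T' (Suc (Suc n)) m" "rm' = T' (Suc (Suc n)) (m - 1)"
  define s where "s = T (Suc (Suc (Suc n))) m"
  define N :: 'a where "N = of_nat (Suc n)"
  define b where "b = a + of_int m"
  note defs = pm_def q_q1_qm_qmm_def q'_qm'_def r_r1_rm_rmm_def r'_rm'_def s_def N_def b_def
  have h1: "x * (rm' * qm - rm * qm') - x * rmm * q + (b - 1) * rm * qm = 0"
    using assms(5) by (simp add: wronskian_n_def defs algebra_simps)
  have h2: "x * (r' * q - r * q') - x * rm * q1 + b * r * q = 0"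
    using assms(4) by (simp add: wronskian_n_def defs algebra_simps)
  have h3: "x * (qm' * q - qm * q') + x * r * pm + N * q * qm = 0"
    using assms(3) by (simp add: wronskian_m_def defs algebra_simps)
  have h4: "s * q - r\<^sup>2 + r1 * rm = 0"
    using toda[of "Suc n" m] by (simp add: defs)
  have h5: "rm * pm - qm\<^sup>2 + q * qmm = 0"
    using toda[of n "m - 1"] by (simp add: defs)
  have h6: "x * (rmm * q + r * qmm) - 2 * (b - 1) * rm * qm = 0"
    using assms(7) by (simp add: shift1_def defs algebra_simps)
  have h7: "x * (rm * q1 + r1 * qm) - 2 * b * r * q = 0"
    using assms(6) by (simp add: shift1_def defs algebra_simps)
  have "q * qm * (x * (rm' * r - rm * r') + x * s * qm + (N + 1) * r * rm) =
      r * q * (x * (rm' * qm - rm * qm') - x * rmm * q + (b - 1) * rm * qm)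
      - rm * qm * (x * (r' * q - r * q') - x * rm * q1 + b * r * q)
      + r * rm * (x * (qm' * q - qm * q') + x * r * pm + N * q * qm)
      + x * qm\<^sup>2 * (s * q - r\<^sup>2 + r1 * rm) - x * r\<^sup>2 * (rm * pm - qm\<^sup>2 + q * qmm)
      + r * q * (x * (rmm * q + r * qmm) - 2 * (b - 1) * rm * qm)
      - rm * qm * (x * (rm * q1 + r1 * qm) - 2 * b * r * q)"
    by (simp add: algebra_simps power2_eq_square)
  also have "\<dots> = 0" unfolding h1 h2 h3 h4 h5 h6 h7 by simp
  finally have "x * (rm' * r - rm * r') + x * s * qm + (N + 1) * r * rm = 0"
    using assms(1,2) by (simp add: defs)
  thus ?thesis by (simp add: wronskian_m_def defs algebra_simps eq_neg_iff_add_eq_0)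
qed

lemma wronskian_n_0: "wronskian_n 0 m"
  using deriv[of m] by (simp add: wronskian_n_def T_0 T'_0 algebra_simps)

lemma wronskian_m_0: "wronskian_m 0 m"
proof -
  have r1: "x * T 1 (m - 1 - 1) + x * T 1 m - 2 * (a + of_int m - 1) * T 1 (m - 1) = 0"
    using recurrence[of "m - 1"] by (simp add: algebra_simps)
  have r2: "x * T 1 (m - 1) + x * T 1 (m + 1) - 2 * (a + of_int m) * T 1 m = 0"
    using recurrence[of m] by (simp add: algebra_simps)
  have d1: "x * T' 1 m - x * T 1 (m - 1) + (a + of_int m) * T 1 m = 0"
    using deriv[of m] by simp
  have d2: "x * T' 1 (m - 1) - x * T 1 (m - 1 - 1) + (a + of_int m - 1) * T 1 (m - 1) = 0"
    using deriv[of "m - 1"] by (simp add: algebra_simps)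
  have "x * (T' 1 (m - 1) * T 1 m - T 1 (m - 1) * T' 1 m)
      + x * ((T 1 m)\<^sup>2 - T 1 (m + 1) * T 1 (m - 1)) + T 1 m * T 1 (m - 1) =
      T 1 m * (x * T' 1 (m - 1) - x * T 1 (m - 1 - 1) + (a + of_int m - 1) * T 1 (m - 1))
      - T 1 (m - 1) * (x * T' 1 m - x * T 1 (m - 1) + (a + of_int m) * T 1 m)
      + T 1 m * (x * T 1 (m - 1 - 1) + x * T 1 m - 2 * (a + of_int m - 1) * T 1 (m - 1))
      - T 1 (m - 1) * (x * T 1 (m - 1) + x * T 1 (m + 1) - 2 * (a + of_int m) * T 1 m)"
    by (simp add: algebra_simps power2_eq_square)
  also have "\<dots> = 0" unfolding r1 r2 d1 d2 by simp
  finally show ?thesis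
    by (simp add: wronskian_m_def T_0 T_2 algebra_simps eq_neg_iff_add_eq_0)
qed

lemma wronskian_identities:
  assumes "\<And>k m. k \<le> n \<Longrightarrow> T k m \<noteq> 0"
  shows "wronskian_n n m \<and> wronskian_m n m"
  using assms
proof (induction n arbitrary: m)
  case 0
  show ?case using wronskian_n_0 wronskian_m_0 by blast
next
  case (Suc n)
  have IH: "wronskian_n n m \<and> wronskian_m n m" for m
    using Suc.IH Suc.prems by simp
  have s1: "shift2 n m" and s2: "shift1 (Suc n) m" for m
    using shift_identities[of n m] shift_identities[of "Suc n" m] Suc.prems by auto
  have "wronskian_n (Suc n) m" for m
    using wronskian_n_Suc[of n m] IH s1 Suc.prems[of n m] by auto
  thus ?case
    using wronskian_m_Suc[of n m] IH s2 Suc.prems by auto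
qed

text \<open>At a double zero \<open>toda_deriv_combination\<close> leaves a single product, which
  forces the neighbour at \<open>m + 1\<close> to vanish too. Then the left side of
  \<open>shift2 n (m + 1)\<close> is zero, whereas its right side is a nonzero multiple of two
  nonvanishing determinants.\<close>

lemma no_double_zero:
  assumes nz: "\<And>k m. k \<le> Suc n \<Longrightarrow> T k m \<noteq> 0"
    and "T (Suc (Suc n)) m = 0" "T' (Suc (Suc n)) m = 0"
  shows False
proof -
  have "wronskian_m n m" for m
    using wronskian_identities[of n] nz by auto
  from toda_deriv_combination[OF this this, of m]
  have "x * T (Suc (Suc n)) (m + 1) * T n m * T (Suc n) (m - 1) = 0"
    using assms(2,3) by simp
  hence "T (Suc (Suc n)) (m + 1) = 0"
    using nz x_nonzero by simp
  moreover have "shift2 n (m + 1)"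
    using shift_identities[of n] nz by auto
  ultimately show False
    using nz assms(2) by (simp add: shift2_def add_eq_0_iff flip: of_nat_Suc)
qed

end

section \<open>Bessel functions near the origin\<close>

lemma slit_plane_eq: "slit_plane = - \<real>\<^sub>\<le>\<^sub>0"
proof -
  have "x \<in> slit_plane \<longleftrightarrow> x \<notin> \<real>\<^sub>\<le>\<^sub>0" for x
    using Arg_bounded[of x] Arg_eq_pi[of x]
    by (auto simp: slit_plane_def complex_nonpos_Reals_iff complex_eq_iff)
  thus ?thesis by blast
qed

lemma open_slit_plane: "open slit_plane"
  by (simp add: slit_plane_eq open_Compl)

lemma connected_slit_plane: "connected slit_plane"
proof -
  have "\<real>\<^sub>\<le>\<^sub>0 = complex_of_real ` {..0}"
    by (auto elim!: nonpos_Reals_cases)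
  thus ?thesis
    using starlike_imp_connected[OF starlike_slotted_complex_plane_left[of 0]]
    by (simp add: slit_plane_eq)
qed

lemma slit_plane_nonzero: "x \<in> slit_plane \<Longrightarrow> x \<noteq> 0"
  by (simp add: slit_plane_def)

lemma half_slit_plane: "x \<in> slit_plane \<Longrightarrow> x / 2 \<notin> \<real>\<^sub>\<le>\<^sub>0"
  by (auto simp: slit_plane_eq complex_nonpos_Reals_iff)

section \<open>The entire factor of the Bessel function of the first kind\<close>

definition bessel_coeff :: "complex \<Rightarrow> nat \<Rightarrow> complex" where
  "bessel_coeff \<nu> k = (-1) ^ k * rGamma (\<nu> + of_nat k + 1) / fact k"

text \<open>In the variable $s = (x/2)^2$ the series is entire, so all branching of $J_\<nu>$ sits
  in the factor $(x/2)^\<nu>$.\<close>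

definition bessel_entire :: "complex \<Rightarrow> complex \<Rightarrow> complex" where
  "bessel_entire \<nu> s = (\<Sum>k. bessel_coeff \<nu> k * s ^ k)"

lemma Bessel_J_conv: "Bessel_J \<nu> x = (x / 2) powr \<nu> * bessel_entire \<nu> ((x / 2)\<^sup>2)"
  by (simp add: Bessel_J_def bessel_entire_def bessel_coeff_def power_mult)

text \<open>Stated without division because \<nu> + k + 1 vanishes for some k when \<nu> is a
  negative integer.\<close>

lemma bessel_coeff_Suc:
  "bessel_coeff \<nu> (Suc k) * ((\<nu> + of_nat k + 1) * of_nat (Suc k)) = - bessel_coeff \<nu> k"
proof -
  have "rGamma (\<nu> + of_nat k + 1) = (\<nu> + of_nat k + 1) * rGamma (\<nu> + of_nat (Suc k) + 1)"
    using rGamma_plus1[of "\<nu> + of_nat k + 1"] by (simp add: algebra_simps)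
  thus ?thesis
    by (simp add: bessel_coeff_def field_simps del: of_nat_Suc)
qed

lemma summable_bessel: "summable (\<lambda>k. bessel_coeff \<nu> k * s ^ k)"
proof -
  \<comment> \<open>From \<open>N\<close> on, |\<nu> + k + 1| is at least 1 and k + 1 is at least
    2|s|, so the ratio of consecutive terms is at most 1/2.\<close>
  obtain N :: nat where N: "norm \<nu> + 2 * norm s + 2 \<le> real N"
    using real_arch_simple by blast
  show ?thesis
  proof (rule summable_ratio_test[of "1/2" N])
    fix k assume k: "k \<ge> N"
    have "real k \<le> norm (of_nat k + 1 :: complex)"
      by (metis norm_of_nat of_nat_Suc add.commute le_add2 of_nat_le_iff plus_1_eq_Suc)
    also have "\<dots> \<le> norm (\<nu> + of_nat k + 1) + norm \<nu>"
      using norm_triangle_ineq4[of "\<nu> + of_nat k + 1" \<nu>] by simp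
    finally have 1: "1 \<le> norm (\<nu> + of_nat k + 1)"
      using N k norm_ge_zero[of s] by linarith
    have 2: "2 * norm s \<le> real (Suc k)"
      using N k norm_ge_zero[of \<nu>] by linarith
    let ?c = "norm (bessel_coeff \<nu> (Suc k))"
    have "?c * norm (s ^ Suc k) * 2 = ?c * (1 * (2 * norm s)) * norm (s ^ k)"
      by (simp add: norm_mult norm_power)
    also have "\<dots> \<le> ?c * (norm (\<nu> + of_nat k + 1) * real (Suc k)) * norm (s ^ k)"
      using 1 2 by (intro mult_right_mono mult_left_mono mult_mono) auto
    also have "?c * (norm (\<nu> + of_nat k + 1) * real (Suc k)) = norm (bessel_coeff \<nu> k)"
      using arg_cong[OF bessel_coeff_Suc[of \<nu> k], of norm] by (simp add: norm_mult del: of_nat_Suc)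
    finally show "norm (bessel_coeff \<nu> (Suc k) * s ^ Suc k) \<le> 1/2 * norm (bessel_coeff \<nu> k * s ^ k)"
      by (simp add: norm_mult)
  qed simp
qed

lemma diffs_bessel_coeff: "diffs (bessel_coeff \<nu>) k = - bessel_coeff (\<nu> + 1) k"
proof -
  have "bessel_coeff \<nu> (Suc k) = - bessel_coeff (\<nu> + 1) k / of_nat (Suc k)"
    by (simp add: bessel_coeff_def algebra_simps)
  thus ?thesis by (simp add: diffs_def del: of_nat_Suc)
qed

lemma bessel_entire_deriv:
  "(bessel_entire \<nu> has_field_derivative - bessel_entire (\<nu> + 1) s) (at s)"
proof -
  have "((\<lambda>s. \<Sum>k. bessel_coeff \<nu> k * s ^ k) has_field_derivative
      (\<Sum>k. diffs (bessel_coeff \<nu>) k * s ^ k)) (at s)"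
    by (rule termdiffs_strong_converges_everywhere) (rule summable_bessel)
  also have "(\<Sum>k. diffs (bessel_coeff \<nu>) k * s ^ k) = - bessel_entire (\<nu> + 1) s"
    unfolding diffs_bessel_coeff bessel_entire_def
    by (simp add: suminf_minus[OF summable_bessel])
  finally show ?thesis unfolding bessel_entire_def .
qed

text \<open>Since $(\<nu> + k) / \<Gamma>(\<nu> + k + 1) = 1 / \<Gamma>(\<nu> + k)$, the
  coefficients for \<nu> - 1 are those for \<nu> multiplied by \<nu> + k. The part with factor k is
  s times the derivative of the series.\<close>

lemma bessel_entire_recurrence:
  "bessel_entire (\<nu> - 1) s = \<nu> * bessel_entire \<nu> s - s * bessel_entire (\<nu> + 1) s"
proof -
  have sums: "(\<lambda>k. bessel_coeff \<mu> k * s ^ k) sums bessel_entire \<mu> s" for \<mu>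
    unfolding bessel_entire_def by (rule summable_sums[OF summable_bessel])
  have "(\<lambda>k. of_nat (Suc k) * bessel_coeff \<nu> (Suc k) * s ^ Suc k) sums
      (- s * bessel_entire (\<nu> + 1) s)"
  proof -
    have "of_nat (Suc k) * bessel_coeff \<nu> (Suc k) * s ^ Suc k =
        - s * (bessel_coeff (\<nu> + 1) k * s ^ k)" for k
      using diffs_bessel_coeff[of \<nu> k] by (simp add: diffs_def del: of_nat_Suc)
    thus ?thesis using sums_mult[OF sums[of "\<nu> + 1"], of "- s"] by simp
  qed
  from sums_Suc[OF this]
  have "(\<lambda>k. of_nat k * bessel_coeff \<nu> k * s ^ k) sums (- s * bessel_entire (\<nu> + 1) s)"
    by simp
  from sums_add[OF sums_mult[OF sums[of \<nu>], of \<nu>] this]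
  have "(\<lambda>k. (\<nu> + of_nat k) * bessel_coeff \<nu> k * s ^ k) sums
      (\<nu> * bessel_entire \<nu> s - s * bessel_entire (\<nu> + 1) s)"
    by (simp add: algebra_simps)
  also have "(\<lambda>k. (\<nu> + of_nat k) * bessel_coeff \<nu> k * s ^ k) = (\<lambda>k. bessel_coeff (\<nu> - 1) k * s ^ k)"
    using rGamma_plus1[of "\<nu> + of_nat k" for k]
    by (simp add: bessel_coeff_def fun_eq_iff)
  finally show ?thesis using sums[of "\<nu> - 1"] sums_unique2 by blast
qed

lemma bessel_entire_0: "bessel_entire \<nu> 0 = rGamma (\<nu> + 1)"
  unfolding bessel_entire_def by (subst powser_zero) (simp add: bessel_coeff_def)

lemma Bessel_J_recurrence:
  assumes "x \<noteq> 0"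
  shows "Bessel_J (\<nu> - 1) x + Bessel_J (\<nu> + 1) x = 2 * \<nu> / x * Bessel_J \<nu> x"
proof -
  define z where "z = x / 2"
  have z: "z \<noteq> 0" "x = 2 * z" using assms by (auto simp: z_def)
  have alg: "P / z * (\<nu> * H - z\<^sup>2 * K) + P * z * K = \<nu> / z * (P * H)" for P H K
    using z(1) by (simp add: field_simps power2_eq_square)
  show ?thesis
    using z alg[of "z powr \<nu>" "bessel_entire \<nu> (z\<^sup>2)" "bessel_entire (\<nu> + 1) (z\<^sup>2)"]
    by (simp add: Bessel_J_conv bessel_entire_recurrence powr_add powr_diff)
qed

lemma Bessel_J_deriv:
  assumes "x \<in> slit_plane"
  shows "(Bessel_J \<nu> has_field_derivative (\<nu> / x * Bessel_J \<nu> x - Bessel_J (\<nu> + 1) x)) (at x)"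
proof -
  let ?z = "x / 2" and ?H = "\<lambda>\<nu>. bessel_entire \<nu> ((x / 2)\<^sup>2)"
  have x0: "x \<noteq> 0" using assms slit_plane_nonzero by blast
  have half: "((\<lambda>x. x / 2) has_field_derivative 1 / 2) (at x)"
    by (auto intro!: derivative_eq_intros)
  have pow: "((\<lambda>x. (x / 2) powr \<nu>) has_field_derivative \<nu> * ?z powr (\<nu> - 1) * (1 / 2)) (at x)"
    using DERIV_chain2[OF has_field_derivative_powr[OF half_slit_plane[OF assms]] half] .
  have sq: "((\<lambda>x. (x / 2)\<^sup>2) has_field_derivative ?z) (at x)"
    by (auto intro!: derivative_eq_intros)
  have ent: "((\<lambda>x. bessel_entire \<nu> ((x / 2)\<^sup>2)) has_field_derivative - ?H (\<nu> + 1) * ?z) (at x)"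
    using DERIV_chain2[OF bessel_entire_deriv sq] .
  have "\<nu> * ?z powr (\<nu> - 1) * (1 / 2) * ?H \<nu> + - ?H (\<nu> + 1) * ?z * ?z powr \<nu> =
      \<nu> / x * Bessel_J \<nu> x - Bessel_J (\<nu> + 1) x"
    using x0 by (simp add: Bessel_J_conv powr_add powr_diff mult_ac)
  with DERIV_mult[OF pow ent] show ?thesis
    unfolding Bessel_J_conv [abs_def] by simp
qed

lemma Bessel_J_tendsto:
  "((\<lambda>x. Bessel_J \<nu> x * (x / 2) powr (- \<nu>)) \<longlongrightarrow> rGamma (\<nu> + 1)) (at 0 within slit_plane)"
proof -
  have "((\<lambda>x. (x / 2)\<^sup>2) has_field_derivative 0) (at (0 :: complex))"
    by (auto intro!: derivative_eq_intros)
  from DERIV_isCont[OF DERIV_chain2[OF bessel_entire_deriv this]]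
  have "isCont (\<lambda>x. bessel_entire \<nu> ((x / 2)\<^sup>2)) 0" .
  hence "((\<lambda>x. bessel_entire \<nu> ((x / 2)\<^sup>2)) \<longlongrightarrow> bessel_entire \<nu> ((0 / 2)\<^sup>2)) (at 0)"
    unfolding isCont_def .
  moreover have "bessel_entire \<nu> ((0 / 2)\<^sup>2) = rGamma (\<nu> + 1)"
    using bessel_entire_0 by simp
  ultimately have "((\<lambda>x. bessel_entire \<nu> ((x / 2)\<^sup>2)) \<longlongrightarrow> rGamma (\<nu> + 1)) (at 0)"
    by simp
  hence "((\<lambda>x. bessel_entire \<nu> ((x / 2)\<^sup>2)) \<longlongrightarrow> rGamma (\<nu> + 1)) (at 0 within slit_plane)"
    by (rule tendsto_mono[OF at_le[OF subset_UNIV]])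
  moreover have "\<forall>\<^sub>F x in at 0 within slit_plane.
      bessel_entire \<nu> ((x / 2)\<^sup>2) = Bessel_J \<nu> x * (x / 2) powr (- \<nu>)"
  proof -
    have "Bessel_J \<nu> x * (x / 2) powr (- \<nu>) = bessel_entire \<nu> ((x / 2)\<^sup>2)" if "x \<noteq> 0" for x
      using that by (simp add: Bessel_J_conv powr_minus)
    thus ?thesis unfolding eventually_at_filter by (intro always_eventually) metis
  qed
  ultimately show ?thesis by (rule Lim_transform_eventually)
qed

text \<open>
  $\mathcal{C}_{a+m}$ for all integers \<open>m\<close> at once: for $a \notin \mathbb{Z}$, passing from $m$ to $m+1$ only flips
  the sign in front of $J_{-a-m}$.
\<close>

definition bessel_seq :: "complex \<Rightarrow> complex \<Rightarrow> complex \<Rightarrow> int \<Rightarrow> complex \<Rightarrow> complex" where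
  "bessel_seq A B a m x = A * Bessel_J (a + of_int m) x + B * (-1) powi m * Bessel_J (- a - of_int m) x"

lemma bessel_seq_recurrence:
  assumes "x \<noteq> 0"
  shows "x * (bessel_seq A B a (m - 1) x + bessel_seq A B a (m + 1) x) =
    2 * (a + of_int m) * bessel_seq A B a m x"
proof -
  define \<nu> where "\<nu> = a + of_int m"
  have J: "x * (Bessel_J (\<mu> - 1) x + Bessel_J (\<mu> + 1) x) = 2 * \<mu> * Bessel_J \<mu> x" for \<mu>
    using Bessel_J_recurrence[OF assms, of \<mu>] assms by (simp add: field_simps)
  have "x * (bessel_seq A B a (m - 1) x + bessel_seq A B a (m + 1) x) =
      A * (x * (Bessel_J (\<nu> - 1) x + Bessel_J (\<nu> + 1) x)) -
      B * (-1) powi m * (x * (Bessel_J (- \<nu> - 1) x + Bessel_J (- \<nu> + 1) x))"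
    by (simp add: bessel_seq_def power_int_add power_int_diff \<nu>_def algebra_simps)
  also have "\<dots> = 2 * \<nu> * bessel_seq A B a m x"
    unfolding J by (simp add: bessel_seq_def \<nu>_def algebra_simps)
  finally show ?thesis by (simp add: \<nu>_def)
qed

lemma bessel_seq_deriv:
  assumes x: "x \<in> slit_plane"
  shows "(bessel_seq A B a m has_field_derivative
    (bessel_seq A B a (m - 1) x - (a + of_int m) / x * bessel_seq A B a m x)) (at x)"
proof -
  define \<nu> where "\<nu> = a + of_int m"
  have x0: "x \<noteq> 0" using x slit_plane_nonzero by blast
  have "(bessel_seq A B a m has_field_derivative
      (A * (\<nu> / x * Bessel_J \<nu> x - Bessel_J (\<nu> + 1) x) +
       B * (-1) powi m * ((- \<nu>) / x * Bessel_J (- \<nu>) x - Bessel_J (- \<nu> + 1) x))) (at x)"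
    using DERIV_add[OF DERIV_cmult[OF Bessel_J_deriv[OF x, of \<nu>], of A]
        DERIV_cmult[OF Bessel_J_deriv[OF x, of "- \<nu>"], of "B * (-1) powi m"]]
    unfolding bessel_seq_def [abs_def] by (simp add: \<nu>_def)
  also have "A * (\<nu> / x * Bessel_J \<nu> x - Bessel_J (\<nu> + 1) x) +
       B * (-1) powi m * ((- \<nu>) / x * Bessel_J (- \<nu>) x - Bessel_J (- \<nu> + 1) x) =
     A * (2 * \<nu> / x * Bessel_J \<nu> x - Bessel_J (\<nu> + 1) x) - B * (-1) powi m * Bessel_J (- \<nu> + 1) x
       - \<nu> / x * bessel_seq A B a m x"
    using x0 by (simp add: bessel_seq_def \<nu>_def field_simps)
  also have "2 * \<nu> / x * Bessel_J \<nu> x - Bessel_J (\<nu> + 1) x = Bessel_J (\<nu> - 1) x"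
    using Bessel_J_recurrence[OF x0, of \<nu>] by (simp add: algebra_simps)
  also have "A * Bessel_J (\<nu> - 1) x - B * (-1) powi m * Bessel_J (- \<nu> + 1) x = bessel_seq A B a (m - 1) x"
    by (simp add: bessel_seq_def power_int_diff \<nu>_def algebra_simps)
  finally show ?thesis by (simp add: \<nu>_def)
qed

lemma bessel_seq_reflect: "bessel_seq B A (- a) (- m) x = (-1) powi m * bessel_seq A B a m x"
proof -
  define s where "s = ((-1) powi m :: complex)"
  have "s * s = 1" "(-1) powi (- m) = s"
    by (simp_all add: s_def power_int_minus_left)
  moreover from this have "s * (s * c) = c" for c
    by (simp flip: mult.assoc)
  ultimately show ?thesis
    by (simp add: bessel_seq_def ring_distribs mult_ac flip: s_def)
qed

lemma bessel_seq_shift: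
  "bessel_seq A B a (k + m) x = bessel_seq A ((-1) powi k * B) (a + of_int k) m x"
  by (simp add: bessel_seq_def power_int_add algebra_simps)

text \<open>The hypothesis excludes integer orders, so \<open>Bessel_Y\<close> is given by its
  quotient and not by the limit. Shifting the order by \<open>m\<close> multiplies both sine and
  cosine by $(-1)^m$; the sign cancels in front of $J_{a+m}$ and survives in front of
  $J_{-a-m}$.\<close>

lemma Bessel_C_conv:
  assumes S: "sin (of_real pi * a) \<noteq> (0::complex)"
  shows "Bessel_C d1 d2 (a + of_int m) x =
    bessel_seq ((d1 * sin (of_real pi * a) + d2 * cos (of_real pi * a)) / sin (of_real pi * a))
      (- d2 / sin (of_real pi * a)) a m x"
proof -
  define s where "s = ((-1) powi m :: complex)"
  have cm: "cos (of_real pi * of_int m :: complex) = s"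
    using cos_of_real[of "pi * of_int m", where 'a = complex]
    by (simp add: cos_npi_int s_def power_int_minus_left)
  have sin_pi_int: "sin (of_real pi * of_int m :: complex) = 0" for m
    using sin_of_real[of "pi * of_int m", where 'a = complex] by simp
  have sin_shift: "sin (of_real pi * (a + of_int m)) = s * sin (of_real pi * a)"
    and cos_shift: "cos (of_real pi * (a + of_int m)) = s * cos (of_real pi * a)"
    by (simp_all add: ring_distribs sin_add cos_add cm sin_pi_int)
  have s: "s * s = 1" "s \<noteq> 0" "inverse s = s"
    by (auto simp: s_def power_int_minus_left)
  have "a + of_int m \<notin> \<int>"
  proof
    assume "a + of_int m \<in> \<int>"
    then obtain k where "a + of_int m = of_int k" by (elim Ints_cases)
    with sin_shift sin_pi_int[of k] S s show False by simp
  qed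
  hence "Bessel_C d1 d2 (a + of_int m) x = d1 * Bessel_J (a + of_int m) x + d2 *
      (Bessel_J (a + of_int m) x * (s * cos (of_real pi * a)) - Bessel_J (- a - of_int m) x) /
        (s * sin (of_real pi * a))"
    unfolding Bessel_C_def Bessel_Y_def Let_def sin_shift cos_shift by simp
  also have "\<dots> = bessel_seq ((d1 * sin (of_real pi * a) + d2 * cos (of_real pi * a)) / sin (of_real pi * a))
      (- d2 / sin (of_real pi * a)) a m x"
    using S s by (simp add: bessel_seq_def field_simps flip: s_def)
  finally show ?thesis .
qed

section \<open>Leading behaviour of the Toeplitz determinants\<close>

text \<open>\<open>K = 0\<close> is allowed, so that \<open>leads f 0 e\<close> says $f = o(x^e)$.\<close>

definition leads :: "(complex \<Rightarrow> complex) \<Rightarrow> complex \<Rightarrow> complex \<Rightarrow> bool" where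
  "leads f K e \<longleftrightarrow> ((\<lambda>x. f x * (x / 2) powr (- e)) \<longlongrightarrow> K) (at 0 within slit_plane)"

section \<open>Calculus of leading powers at the branch point\<close>

lemma eventually_slit_plane: "\<forall>\<^sub>F x in at 0 within slit_plane. x \<in> slit_plane"
  unfolding eventually_at_filter by (rule always_eventually) blast

lemma slit_filter_nontrivial: "at 0 within slit_plane \<noteq> bot"
proof -
  have "\<exists>y\<in>slit_plane. y \<noteq> 0 \<and> dist y 0 < e" if "e > 0" for e
  proof
    show "of_real (e / 2) \<in> slit_plane"
      using that by (auto simp: slit_plane_eq complex_nonpos_Reals_iff)
  qed (use that in auto)
  hence "(0 :: complex) islimpt slit_plane"
    by (auto simp: islimpt_approachable)
  thus ?thesis by (simp add: trivial_limit_within)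
qed

text \<open>For nonreal e the modulus is $|x/2|^{Re e}$ times $exp(- Im e Arg(x/2))$, and the second
  factor is bounded because the principal argument is. Hence orders of magnitude may be compared by
  real parts alone.\<close>

lemma half_powr_tendsto_0:
  assumes "Re e > 0"
  shows "((\<lambda>x. (x / 2) powr e) \<longlongrightarrow> 0) (at 0 within slit_plane)"
proof -
  have "((\<lambda>x :: complex. x / 2) \<longlongrightarrow> 0 / 2) (at 0 within slit_plane)"
    by (intro tendsto_intros) simp_all
  thus ?thesis
    using assms by (intro tendsto_powr_complex_0[where b = e]) auto
qed

lemma leads_transform:
  assumes "leads f K e" "\<forall>\<^sub>F x in at 0 within slit_plane. f x = g x"
  shows "leads g K e"
  unfolding leads_def
  by (rule Lim_transform_eventually[OF assms(1)[unfolded leads_def]])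
     (use assms(2) in eventually_elim, simp)

lemma leads_mult:
  assumes "leads f K e" "leads g L d"
  shows "leads (\<lambda>x. f x * g x) (K * L) (e + d)"
proof -
  have "((\<lambda>x. (f x * (x / 2) powr (- e)) * (g x * (x / 2) powr (- d))) \<longlongrightarrow> K * L)
      (at 0 within slit_plane)"
    using assms unfolding leads_def by (rule tendsto_mult)
  also have "(\<lambda>x. (f x * (x / 2) powr (- e)) * (g x * (x / 2) powr (- d))) =
      (\<lambda>x. f x * g x * (x / 2) powr (- (e + d)))"
  proof
    fix x :: complex
    have "(x / 2) powr (- (e + d)) = (x / 2) powr (- e) * (x / 2) powr (- d)"
      using powr_add[of "x / 2" "- e" "- d"] by simp
    thus "(f x * (x / 2) powr (- e)) * (g x * (x / 2) powr (- d)) =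
      f x * g x * (x / 2) powr (- (e + d))" by (simp add: mult_ac)
  qed
  finally show ?thesis unfolding leads_def .
qed

lemma leads_cmult: "leads f K e \<Longrightarrow> leads (\<lambda>x. c * f x) (c * K) e"
  unfolding leads_def using tendsto_mult_left[of _ K _ c] by (simp add: mult.assoc)

lemma leads_add:
  assumes "leads f K e" "leads g L e"
  shows "leads (\<lambda>x. f x + g x) (K + L) e"
  using tendsto_add[OF assms[unfolded leads_def]] by (simp add: leads_def ring_distribs)

lemma leads_diff:
  assumes "leads f K e" "leads g L e"
  shows "leads (\<lambda>x. f x - g x) (K - L) e"
  using tendsto_diff[OF assms[unfolded leads_def]] by (simp add: leads_def ring_distribs)

lemma leads_power: "leads f K e \<Longrightarrow> leads (\<lambda>x. f x ^ 2) (K ^ 2) (2 * e)"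
  using leads_mult[of f K e f K e] by (simp add: power2_eq_square)

lemma leads_higher:
  assumes "leads f K e" "Re d < Re e"
  shows "leads f 0 d"
proof -
  have "((\<lambda>x. (f x * (x / 2) powr (- e)) * (x / 2) powr (e - d)) \<longlongrightarrow> K * 0)
      (at 0 within slit_plane)"
    using assms unfolding leads_def
    by (intro tendsto_mult half_powr_tendsto_0) auto
  also have "(\<lambda>x. (f x * (x / 2) powr (- e)) * (x / 2) powr (e - d)) =
      (\<lambda>x. f x * (x / 2) powr (- d))"
  proof
    fix x :: complex
    have "(x / 2) powr (- d) = (x / 2) powr (- e) * (x / 2) powr (e - d)"
      using powr_add[of "x / 2" "- e" "e - d"] by simp
    thus "(f x * (x / 2) powr (- e)) * (x / 2) powr (e - d) = f x * (x / 2) powr (- d)"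
      by (simp add: mult_ac)
  qed
  finally show ?thesis by (simp add: leads_def)
qed

lemma leads_nonzero:
  assumes "leads f K e" "K \<noteq> 0"
  shows "\<forall>\<^sub>F x in at 0 within slit_plane. f x \<noteq> 0"
proof -
  have "\<forall>\<^sub>F x in at 0 within slit_plane. f x * (x / 2) powr (- e) \<noteq> 0"
    using assms unfolding leads_def by (rule tendsto_imp_eventually_ne)
  thus ?thesis by eventually_elim auto
qed

lemma leads_divide:
  assumes "leads f K e" "leads g L d" "L \<noteq> 0"
  shows "leads (\<lambda>x. f x / g x) (K / L) (e - d)"
proof -
  have "((\<lambda>x. (f x * (x / 2) powr (- e)) / (g x * (x / 2) powr (- d))) \<longlongrightarrow> K / L)
      (at 0 within slit_plane)"
    using assms unfolding leads_def by (intro tendsto_divide)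
  also have "(\<lambda>x. (f x * (x / 2) powr (- e)) / (g x * (x / 2) powr (- d))) =
      (\<lambda>x. f x / g x * (x / 2) powr (- (e - d)))"
  proof
    fix x :: complex
    have "(x / 2) powr (- (e - d)) = (x / 2) powr (- e) / (x / 2) powr (- d)"
      using powr_diff[of "x / 2" "- e" "- d"] by simp
    thus "(f x * (x / 2) powr (- e)) / (g x * (x / 2) powr (- d)) =
      f x / g x * (x / 2) powr (- (e - d))" by simp
  qed
  finally show ?thesis unfolding leads_def .
qed

text \<open>The form in which the Toda equation is solved for the largest determinant: the leading
  term of a product and of one nonvanishing factor determine that of the other factor.\<close>

lemma leads_cancel:
  assumes "leads (\<lambda>x. f x * g x) (K * L) e" "leads g L d" "L \<noteq> 0" "e' = e - d"
  shows "leads f K e'"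
proof (rule leads_transform)
  show "leads (\<lambda>x. f x * g x / g x) K e'"
    using leads_divide[OF assms(1,2,3)] assms(3,4) by simp
  show "\<forall>\<^sub>F x in at 0 within slit_plane. f x * g x / g x = f x"
    using leads_nonzero[OF assms(2,3)] by eventually_elim simp
qed

lemma leads_0_iff: "leads f K 0 \<longleftrightarrow> (f \<longlongrightarrow> K) (at 0 within slit_plane)"
  unfolding leads_def
  by (intro tendsto_cong, rule eventually_mono[OF eventually_slit_plane]) (auto dest: slit_plane_nonzero)

lemma leads_const: "leads (\<lambda>_. c) c 0"
  by (simp add: leads_0_iff)

lemma leads_id: "leads (\<lambda>x. x) 2 1"
proof -
  have "((\<lambda>_. 2) \<longlongrightarrow> (2 :: complex)) (at 0 within slit_plane)" by simp
  thus ?thesis unfolding leads_def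
    by (rule Lim_transform_eventually)
       (rule eventually_mono[OF eventually_slit_plane],
         auto dest: slit_plane_nonzero simp: powr_minus)
qed

lemma leads_imp_asymp_equiv:
  assumes "leads f K e" "K \<noteq> 0"
  shows "f \<sim>[at 0 within slit_plane] (\<lambda>x. K * (x / 2) powr e)"
proof (rule asymp_equivI'_const)
  show "((\<lambda>x. f x / (x / 2) powr e) \<longlongrightarrow> K) (at 0 within slit_plane)"
    using assms(1) by (simp add: leads_def powr_minus_divide)
qed fact

section \<open>Leading terms of the seed functions and of the determinants\<close>

lemma Bessel_J_leads: "leads (Bessel_J \<nu>) (rGamma (\<nu> + 1)) \<nu>"
  unfolding leads_def by (rule Bessel_J_tendsto)

lemma bessel_seq_leads_neg:
  assumes "A = 0 \<or> Re (a + of_int m) > 0"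
  shows "leads (bessel_seq A B a m) (B * (-1) powi m * rGamma (1 - a - of_int m)) (- (a + of_int m))"
proof -
  have 1: "leads (\<lambda>x. A * Bessel_J (a + of_int m) x) 0 (- (a + of_int m))"
  proof (cases "A = 0")
    case False
    thus ?thesis
      using leads_higher[OF leads_cmult[OF Bessel_J_leads]] assms by simp
  qed (simp add: leads_def)
  have 2: "leads (\<lambda>x. (B * (-1) powi m) * Bessel_J (- a - of_int m) x)
      ((B * (-1) powi m) * rGamma (- a - of_int m + 1)) (- (a + of_int m))"
    using leads_cmult[OF Bessel_J_leads[of "- a - of_int m"], of "B * (-1) powi m"] by simp
  show ?thesis
    using leads_add[OF 1 2] by (simp add: bessel_seq_def [abs_def] algebra_simps)
qed

lemma bessel_seq_leads_pos:
  assumes "Re (a + of_int m) < 0"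
  shows "leads (bessel_seq A B a m) (A * rGamma (1 + a + of_int m)) (a + of_int m)"
proof -
  have 1: "leads (\<lambda>x. (B * (-1) powi m) * Bessel_J (- a - of_int m) x) 0 (a + of_int m)"
    using leads_higher[OF leads_cmult[OF Bessel_J_leads]] assms by simp
  have 2: "leads (\<lambda>x. A * Bessel_J (a + of_int m) x) (A * rGamma (a + of_int m + 1)) (a + of_int m)"
    by (rule leads_cmult[OF Bessel_J_leads])
  show ?thesis
    using leads_add[OF 2 1] by (simp add: bessel_seq_def [abs_def] algebra_simps)
qed

text \<open>This is \<open>Bessel_Delta\<close> at \<alpha> = 2(a + m). The solution $u_n$ involves
  only m = 0 and m = -1, but the Toda equation couples each m to its neighbours.\<close>

definition tau :: "complex \<Rightarrow> complex \<Rightarrow> complex \<Rightarrow> nat \<Rightarrow> int \<Rightarrow> complex \<Rightarrow> complex" where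
  "tau A B a n m x = fdet n (\<lambda>j k. bessel_seq A B a (m - int j + int k) x)"

lemma tau_0 [simp]: "tau A B a 0 m x = 1"
  by (simp add: tau_def)

lemma tau_1 [simp]: "tau A B a (Suc 0) m x = bessel_seq A B a m x"
  by (simp add: tau_def)

text \<open>Minors of a Toeplitz matrix are Toeplitz again: dropping the first row lowers
  \<open>m\<close> by one, dropping the first column raises it by one, and dropping both leaves it
  unchanged.\<close>

lemma tau_toda:
  "tau A B a (Suc (Suc n)) m x * tau A B a n m x =
    (tau A B a (Suc n) m x)\<^sup>2 - tau A B a (Suc n) (m + 1) x * tau A B a (Suc n) (m - 1) x"
proof -
  let ?f = "\<lambda>j k. bessel_seq A B a (m - int j + int k) x"
  have "fdet l (\<lambda>j k. ?f (Suc j) (Suc k)) = tau A B a l m x" for l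
    unfolding tau_def by (intro fdet_cong arg_cong[where f = "\<lambda>i. bessel_seq A B a i x"]) simp
  moreover have "fdet l (\<lambda>j k. ?f (Suc j) k) = tau A B a l (m - 1) x" for l
    unfolding tau_def by (intro fdet_cong arg_cong[where f = "\<lambda>i. bessel_seq A B a i x"]) simp
  moreover have "fdet l (\<lambda>j k. ?f j (Suc k)) = tau A B a l (m + 1) x" for l
    unfolding tau_def by (intro fdet_cong arg_cong[where f = "\<lambda>i. bessel_seq A B a i x"]) simp
  ultimately show ?thesis
    using desnanot_jacobi[of n ?f] by (simp add: tau_def power2_eq_square mult.commute)
qed

lemma tau_shift:
  "tau A B a n (k + m) x = tau A ((-1) powi k * B) (a + of_int k) n m x"
proof -
  have "k + m - int i + int j = k + (m - int i + int j)" for i j by simp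
  thus ?thesis unfolding tau_def by (simp only: bessel_seq_shift)
qed

text \<open>Closed form of the n by n Toeplitz determinant with entries $1 / \<Gamma>(1 - b + j -
  k)$, which is what remains when each $J_{-a-m}$ is replaced by its leading coefficient.\<close>

definition rGamma_prod :: "nat \<Rightarrow> complex \<Rightarrow> complex" where
  "rGamma_prod n b = (\<Prod>q<n. fact q * rGamma (1 + of_nat q - b))"

lemma rGamma_prod_shift:
  "rGamma_prod n (b + 1) * rGamma (of_nat n - b) = rGamma_prod n b * rGamma (- b)"
proof -
  have "(\<Prod>q<n. rGamma (of_nat q - b)) * rGamma (of_nat n - b) = (\<Prod>q<Suc n. rGamma (of_nat q - b))"
    by simp
  also have "\<dots> = rGamma (- b) * (\<Prod>q<n. rGamma (1 + of_nat q - b))"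
    by (simp only: prod.lessThan_Suc_shift) simp
  finally show ?thesis
    by (simp add: rGamma_prod_def prod.distrib mult_ac)
qed

lemma nonint_shift: "a \<notin> \<int> \<Longrightarrow> a + of_int m \<notin> (\<int> :: complex set)"
  by (metis Ints_diff Ints_of_int add_diff_cancel_right')

lemma nonint_reflect: "a \<notin> \<int> \<Longrightarrow> of_int m - a \<notin> (\<int> :: complex set)"
  using nonint_shift[of "- a" m] by simp

lemma rGamma_nonint: "z \<notin> \<int> \<Longrightarrow> rGamma (z :: complex) \<noteq> 0"
  using not_in_Ints_imp_not_in_nonpos_Ints by (simp add: rGamma_eq_zero_iff)

lemma rGamma_prod_nonzero:
  assumes "b \<notin> \<int>"
  shows "rGamma_prod n b \<noteq> 0"
proof -
  have "1 + of_nat q - b \<notin> \<int>" for q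
    using nonint_reflect[OF assms, of "1 + int q"] by simp
  thus ?thesis by (simp add: rGamma_prod_def rGamma_nonint)
qed

text \<open>
  Leading coefficient of \<open>tau A B a n m\<close> when only the terms with $J_{-a-m}$ matter. It solves the Toda
  equation by itself.
\<close>

definition kappa :: "complex \<Rightarrow> complex \<Rightarrow> nat \<Rightarrow> int \<Rightarrow> complex" where
  "kappa B a n m = (B * (-1) powi m) ^ n * rGamma_prod n (a + of_int m)"

lemma kappa_nonzero: "B \<noteq> 0 \<Longrightarrow> a \<notin> \<int> \<Longrightarrow> kappa B a n m \<noteq> 0"
  by (simp add: kappa_def rGamma_prod_nonzero nonint_shift)

text \<open>Both terms on the right have the same order of magnitude, so the coefficient has to be
  computed exactly. With t = n + 1 - b, the product of the two neighbours is -b/t times the square,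
  and 1 + b/t = (n + 1)/t is the nonzero factor that remains.\<close>

lemma kappa_toda:
  assumes a: "a \<notin> \<int>"
  shows "kappa B a (Suc (Suc n)) m * kappa B a n m =
    (kappa B a (Suc n) m)\<^sup>2 - kappa B a (Suc n) (m + 1) * kappa B a (Suc n) (m - 1)"
proof -
  define b where "b = a + of_int m"
  define c where "c = B * (-1) powi m"
  define G where "G = rGamma_prod n b"
  define t where "t = of_nat (Suc n) - b"
  have b: "b \<notin> \<int>" using a nonint_shift by (simp add: b_def)
  have b0: "1 - b \<notin> \<int>" "of_nat k - b \<notin> \<int>" for k
    using nonint_reflect[OF b, of 1] nonint_reflect[OF b, of "int k"] by simp_all
  have t: "t \<notin> \<int>" using b0 by (simp add: t_def)
  have t0: "t \<noteq> 0" using t Ints_0 by metis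
  have R: "rGamma t = t * rGamma (t + 1)" "rGamma (- b) = - b * rGamma (1 - b)"
    using rGamma_plus1[of t] rGamma_plus1[of "- b"] by (simp_all add: add.commute)
  have nz: "rGamma (t + 1) \<noteq> 0" "rGamma t \<noteq> 0" "rGamma (1 - b) \<noteq> 0"
    using rGamma_nonint[OF b0(1)] rGamma_nonint[OF t] R(1) by auto
  have G1: "rGamma_prod (Suc n) b = G * fact n * rGamma t"
    by (simp add: rGamma_prod_def G_def t_def add.commute diff_add_eq mult.assoc)
  have G2: "rGamma_prod (Suc (Suc n)) b = G * fact n * rGamma t * fact (Suc n) * rGamma (t + 1)"
    by (simp add: rGamma_prod_def G_def t_def algebra_simps)
  have up: "rGamma_prod (Suc n) (b + 1) * rGamma t = rGamma_prod (Suc n) b * (- b * rGamma (1 - b))"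
    using rGamma_prod_shift[of "Suc n" b] R(2) by (simp add: t_def)
  have down: "rGamma_prod (Suc n) b * rGamma (t + 1) = rGamma_prod (Suc n) (b - 1) * rGamma (1 - b)"
    using rGamma_prod_shift[of "Suc n" "b - 1"] by (simp add: t_def algebra_simps)
  have prods: "rGamma_prod (Suc n) (b + 1) * rGamma_prod (Suc n) (b - 1) =
      (rGamma_prod (Suc n) b)\<^sup>2 * (- b / t)"
  proof -
    have "(rGamma_prod (Suc n) (b + 1) * rGamma t) * (rGamma_prod (Suc n) (b - 1) * rGamma (1 - b)) =
       (rGamma_prod (Suc n) b * (- b * rGamma (1 - b))) * (rGamma_prod (Suc n) b * rGamma (t + 1))"
      using up down by simp
    moreover have "X * Y * t = P\<^sup>2 * (- b)"
      if "(X * (t * r)) * (Y * s) = (P * (- b * s)) * (P * r)" "r \<noteq> 0" "s \<noteq> 0" for X Y P r s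
    proof -
      have "(r * s) * (X * Y * t - P\<^sup>2 * (- b)) = 0"
        using that(1) by (simp add: algebra_simps power2_eq_square)
      thus ?thesis using that(2,3) by (simp add: eq_neg_iff_add_eq_0)
    qed
    ultimately have "rGamma_prod (Suc n) (b + 1) * rGamma_prod (Suc n) (b - 1) * t =
      (rGamma_prod (Suc n) b)\<^sup>2 * (- b)"
      using nz unfolding R(1) by blast
    thus ?thesis using t0 by (simp add: field_simps)
  qed
  have "kappa B a (Suc n) (m + 1) * kappa B a (Suc n) (m - 1) =
      c ^ Suc n * c ^ Suc n * (rGamma_prod (Suc n) (b + 1) * rGamma_prod (Suc n) (b - 1))"
  proof -
    have "(B * (-1) powi (m + 1)) ^ Suc n * (B * (-1) powi (m - 1)) ^ Suc n = c ^ Suc n * c ^ Suc n"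
      by (simp only: power_mult_distrib [symmetric]) (simp add: c_def power_int_add power_int_diff)
    thus ?thesis by (simp add: kappa_def b_def add_ac mult_ac diff_add_eq add_diff_eq)
  qed
  moreover have "kappa B a (Suc n) m = c ^ Suc n * rGamma_prod (Suc n) b"
    by (simp add: kappa_def b_def c_def)
  moreover have "kappa B a (Suc (Suc n)) m * kappa B a n m =
      c ^ Suc n * c ^ Suc n * (rGamma_prod (Suc (Suc n)) b * G)"
    by (simp add: kappa_def b_def c_def G_def)
  moreover have "rGamma_prod (Suc (Suc n)) b * G =
      (rGamma_prod (Suc n) b)\<^sup>2 * (1 + b / t)"
  proof -
    have "1 + b / t = of_nat (Suc n) / t"
      using t0 by (simp add: field_simps t_def)
    thus ?thesis using t0 unfolding G1 G2 R(1)
      by (simp add: power2_eq_square field_simps)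
  qed
  ultimately show ?thesis
    unfolding prods by (simp only: power2_eq_square) (simp add: algebra_simps del: power_Suc)
qed

text \<open>The square and the product in the Toda equation have equal exponents. The lower bound on
  \<open>Re (a + of_int m)\<close> grows with \<open>n\<close> because each step uses the preceding
  level at \<open>m - 1\<close>.\<close>

lemma tau_leads_neg:
  assumes a: "a \<notin> \<int>" and B: "B \<noteq> 0"
    and "A = 0 \<or> Re (a + of_int m) > real n - 1"
  shows "leads (tau A B a n m) (kappa B a n m) (- of_nat n * (a + of_int m))"
  using assms(3)
proof (induction n arbitrary: m rule: induct_nat_012)
  case 0
  have "tau A B a 0 m = (\<lambda>_. 1)" by (simp add: fun_eq_iff)
  thus ?case using leads_const[of 1] by (simp add: kappa_def rGamma_prod_def)
next
  case 1
  have "tau A B a (Suc 0) m = bessel_seq A B a m" by (simp add: fun_eq_iff)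
  thus ?case
    using bessel_seq_leads_neg[of A a m B] 1
    by (simp add: kappa_def rGamma_prod_def algebra_simps)
next
  case (ge2 n)
  let ?e = "- of_nat (Suc n) * (a + of_int m)"
  have sq: "leads (\<lambda>x. (tau A B a (Suc n) m x)\<^sup>2) ((kappa B a (Suc n) m)\<^sup>2) (2 * ?e)"
    using ge2 by (intro leads_power ge2.IH) auto
  have "leads (\<lambda>x. tau A B a (Suc n) (m + 1) x * tau A B a (Suc n) (m - 1) x)
      (kappa B a (Suc n) (m + 1) * kappa B a (Suc n) (m - 1))
      (- of_nat (Suc n) * (a + of_int (m + 1)) + - of_nat (Suc n) * (a + of_int (m - 1)))"
    using ge2 by (intro leads_mult ge2.IH) auto
  moreover have "- of_nat (Suc n) * (a + of_int (m + 1)) + - of_nat (Suc n) * (a + of_int (m - 1)) = 2 * ?e"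
    by (simp add: algebra_simps)
  ultimately have "leads (\<lambda>x. tau A B a (Suc (Suc n)) m x * tau A B a n m x)
      (kappa B a (Suc (Suc n)) m * kappa B a n m) (2 * ?e)"
    unfolding tau_toda kappa_toda[OF a] using leads_diff[OF sq] by simp
  moreover have IHn: "leads (tau A B a n m) (kappa B a n m) (- of_nat n * (a + of_int m))"
    using ge2 by (intro ge2.IH) auto
  ultimately show ?case
    by (rule leads_cancel) (simp_all add: kappa_nonzero[OF B a] algebra_simps)
qed

text \<open>
  Leading coefficient of \<open>tau A B a (Suc n) m\<close> in the next strip of \<open>Re a\<close>, where exactly one factor
  $J_{a+m}$ enters. There the product in the Toda equation dominates the square.
\<close>

definition lambda :: "complex \<Rightarrow> complex \<Rightarrow> complex \<Rightarrow> nat \<Rightarrow> int \<Rightarrow> complex" where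
  "lambda A B a n m = A * (B * (-1) powi m) ^ n * rGamma_prod n (a + of_int m + 1) *
     rGamma (1 + a + of_int m - of_nat n)"

lemma lambda_toda:
  "lambda A B a (Suc n) m * kappa B a n m = - kappa B a (Suc n) (m + 1) * lambda A B a n (m - 1)"
proof -
  have s: "B * (-1) powi (m + 1) = - (B * (-1) powi m)" "B * (-1) powi (m - 1) = - (B * (-1) powi m)"
    by (simp_all add: power_int_add power_int_diff)
  have e: "a + of_int (m + 1) = a + of_int m + 1" "a + of_int (m - 1) + 1 = a + of_int m"
    "1 + a + of_int (m - 1) - of_nat n = 1 + a + of_int m - of_nat (Suc n)"
    by simp_all
  have "(- 1 :: complex) ^ Suc n * (- 1) ^ n = - 1"
    by (simp flip: power_mult_distrib)
  thus ?thesis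
    unfolding lambda_def kappa_def s e power_minus[of "B * (-1) powi m"]
    by (simp add: mult_ac)
qed

lemma tau_leads_pos:
  assumes a: "a \<notin> \<int>" and B: "B \<noteq> 0"
    and "real n - 1 < Re (a + of_int m)" "Re (a + of_int m) < real n"
  shows "leads (tau A B a (Suc n) m) (lambda A B a n m) ((1 - of_nat n) * (a + of_int m) - 2 * of_nat n)"
  using assms(3,4)
proof (induction n arbitrary: m)
  case 0
  have "tau A B a (Suc 0) m = bessel_seq A B a m" by (simp add: fun_eq_iff)
  thus ?case
    using bessel_seq_leads_pos[of a m A B] 0
    by (simp add: lambda_def rGamma_prod_def algebra_simps)
next
  case (Suc n)
  let ?b = "a + of_int m"
  let ?e = "- of_nat (Suc n) * (?b + 1) + ((1 - of_nat n) * (?b - 1) - 2 * of_nat n)"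
  have "leads (\<lambda>x. (tau A B a (Suc n) m x)\<^sup>2) ((kappa B a (Suc n) m)\<^sup>2) (2 * (- of_nat (Suc n) * ?b))"
    using Suc.prems by (intro leads_power tau_leads_neg a B) auto
  \<comment> \<open>The exponent of the square exceeds \<open>?e\<close> by 2(n + 1 - b), where b is
    \<open>?b\<close>; its real part is positive by the upper bound of the strip.\<close>
  hence sq: "leads (\<lambda>x. (tau A B a (Suc n) m x)\<^sup>2) 0 ?e"
    by (rule leads_higher) (use Suc.prems in \<open>simp add: algebra_simps\<close>)
  have up: "leads (tau A B a (Suc n) (m + 1)) (kappa B a (Suc n) (m + 1)) (- of_nat (Suc n) * (?b + 1))"
    using tau_leads_neg[OF a B, of A "Suc n" "m + 1"] Suc.prems by (simp add: add.assoc)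
  have down: "leads (tau A B a (Suc n) (m - 1)) (lambda A B a n (m - 1))
      ((1 - of_nat n) * (?b - 1) - 2 * of_nat n)"
    using Suc.IH[of "m - 1"] Suc.prems by (simp add: add_diff_eq)
  have "leads (\<lambda>x. tau A B a (Suc (Suc n)) m x * tau A B a n m x)
      (lambda A B a (Suc n) m * kappa B a n m) ?e"
    unfolding tau_toda lambda_toda using leads_diff[OF sq leads_mult[OF up down]] by simp
  moreover have IHn: "leads (tau A B a n m) (kappa B a n m) (- of_nat n * ?b)"
    using Suc.prems by (intro tau_leads_neg a B) auto
  ultimately show ?case
    by (rule leads_cancel) (simp_all add: kappa_nonzero[OF B a] algebra_simps)
qed

section \<open>Identities on the slit plane and the Painleve equation\<close>

text \<open>A continuous function that is positive exactly off the cut exhibits the slit plane as a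
  countable union of closed superlevel sets, as the identity theorem for uncountable zero sets
  presupposes.\<close>

lemma slit_plane_eq_Collect: "slit_plane = {x. 0 < Re x + cmod x}"
proof -
  have "x \<in> \<real>\<^sub>\<le>\<^sub>0 \<longleftrightarrow> \<not> 0 < Re x + cmod x" for x
  proof
    assume "\<not> 0 < Re x + cmod x"
    hence "cmod x \<le> - Re x" by simp
    moreover from this have "(cmod x)\<^sup>2 \<le> (- Re x)\<^sup>2" by (intro power_mono) auto
    hence "Im x = 0" by (simp add: cmod_power2)
    ultimately show "x \<in> \<real>\<^sub>\<le>\<^sub>0"
      using norm_ge_zero[of x] by (simp add: complex_nonpos_Reals_iff del: norm_ge_zero)
  qed (auto simp: complex_nonpos_Reals_iff cmod_eq_Re)
  thus ?thesis by (auto simp: slit_plane_eq)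
qed

lemma fsigma_slit_plane: "fsigma slit_plane"
proof -
  have "slit_plane = (\<Union>n::nat. {x. inverse (real (Suc n)) \<le> Re x + cmod x})"
  proof (rule equalityI; rule subsetI)
    fix x assume "x \<in> slit_plane"
    then obtain n where "inverse (real (Suc n)) < Re x + cmod x"
      using reals_Archimedean by (auto simp: slit_plane_eq_Collect)
    thus "x \<in> (\<Union>n::nat. {x. inverse (real (Suc n)) \<le> Re x + cmod x})"
      using less_imp_le by blast
  next
    fix x assume "x \<in> (\<Union>n::nat. {x. inverse (real (Suc n)) \<le> Re x + cmod x})"
    then obtain n where "inverse (real (Suc n)) \<le> Re x + cmod x" by blast
    thus "x \<in> slit_plane"
      using order.strict_trans2[of 0 "inverse (real (Suc n))"] by (simp add: slit_plane_eq_Collect)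
  qed
  moreover have "closed {x. inverse (real (Suc n)) \<le> Re x + cmod x}" for n
    by (intro closed_Collect_le continuous_intros)
  ultimately show ?thesis
    by (metis (no_types, lifting) fsigma.intros)
qed

lemma uncountable_slit_plane_minus:
  assumes "countable N"
  shows "uncountable (slit_plane - N)"
proof
  assume "countable (slit_plane - N)"
  hence *: "countable ((slit_plane - N) \<union> N)" using assms by blast
  have "(1 :: complex) \<in> slit_plane" by (simp add: slit_plane_eq_Collect)
  then obtain r where "r > 0" "ball 1 r \<subseteq> slit_plane"
    using open_slit_plane by (metis openE)
  have "ball 1 r \<subseteq> (slit_plane - N) \<union> N"
    using \<open>ball 1 r \<subseteq> slit_plane\<close> by blast
  from countable_subset[OF this *] show False
    using uncountable_ball[OF \<open>r > 0\<close>, of "1 :: complex"] by blast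
qed

text \<open>The exceptional set will be a union of zero sets over all integers \<open>m\<close>.
  Such a union may accumulate inside the domain but stays countable, so agreement is compared on an
  uncountable set.\<close>

lemma slit_plane_identity:
  assumes "f holomorphic_on slit_plane" "g holomorphic_on slit_plane" "countable N"
    and "\<And>x. x \<in> slit_plane \<Longrightarrow> x \<notin> N \<Longrightarrow> f x = g x" and "x \<in> slit_plane"
  shows "f x = g x"
proof -
  have "slit_plane - N \<subseteq> {x \<in> slit_plane. f x = g x}" using assms(4) by blast
  hence "uncountable {x \<in> slit_plane. f x = g x}"
    using uncountable_slit_plane_minus[OF assms(3)] countable_subset by blast
  from holomorphic_countable_equal[OF assms(1,2) open_slit_plane connected_slit_plane
      fsigma_slit_plane this]
  show ?thesis using assms(5) by blast
qed

lemma countable_slit_plane_zeros: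
  assumes "f holomorphic_on slit_plane" "y \<in> slit_plane" "f y \<noteq> 0"
  shows "countable {x \<in> slit_plane. f x = 0}"
proof (rule ccontr)
  assume "uncountable {x \<in> slit_plane. f x = 0}"
  from holomorphic_countable_equal[OF assms(1) holomorphic_on_const open_slit_plane
      connected_slit_plane fsigma_slit_plane this]
  show False using assms(2,3) by blast
qed

lemma fdet_holomorphic:
  assumes "\<And>i j. i < n \<Longrightarrow> j < n \<Longrightarrow> (\<lambda>x. f i j x) holomorphic_on S"
  shows "(\<lambda>x. fdet n (\<lambda>i j. f i j x)) holomorphic_on S"
proof -
  have "(\<lambda>x. \<Sum>p\<in>{p. p permutes {0..<n}}. signof p * (\<Prod>i=0..<n. f i (p i) x)) holomorphic_on S"
    using permutes_in_image by (intro holomorphic_intros assms) fastforce+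
  thus ?thesis by (simp only: fdet_permutations)
qed

lemma bessel_seq_holomorphic: "bessel_seq A B a m holomorphic_on slit_plane"
  unfolding holomorphic_on_def field_differentiable_def
  using bessel_seq_deriv DERIV_subset by blast

lemma tau_holomorphic [holomorphic_intros]: "tau A B a n m holomorphic_on slit_plane"
  unfolding tau_def [abs_def] by (intro fdet_holomorphic bessel_seq_holomorphic)

lemma tau_has_deriv:
  "x \<in> slit_plane \<Longrightarrow> (tau A B a n m has_field_derivative deriv (tau A B a n m) x) (at x)"
  using holomorphic_derivI[OF tau_holomorphic open_slit_plane] .

lemma bessel_toda_tau:
  assumes x: "x \<in> slit_plane"
  shows "bessel_toda (\<lambda>n m. tau A B a n m x) (\<lambda>n m. deriv (tau A B a n m) x) x a"
proof
  note D = tau_has_deriv[OF x, of A B a]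
  show "x \<noteq> 0" using x slit_plane_nonzero by blast
  show "deriv (tau A B a 0 m) x = 0" for m
  proof -
    have "tau A B a 0 m = (\<lambda>_. 1)" by (simp add: fun_eq_iff)
    thus ?thesis by simp
  qed
  show "tau A B a (Suc (Suc n)) m x * tau A B a n m x =
      (tau A B a (Suc n) m x)\<^sup>2 - tau A B a (Suc n) (m + 1) x * tau A B a (Suc n) (m - 1) x" for n m
    by (rule tau_toda)
  show "deriv (tau A B a (Suc (Suc n)) m) x * tau A B a n m x +
      tau A B a (Suc (Suc n)) m x * deriv (tau A B a n m) x =
      2 * tau A B a (Suc n) m x * deriv (tau A B a (Suc n) m) x -
      deriv (tau A B a (Suc n) (m + 1)) x * tau A B a (Suc n) (m - 1) x -
      tau A B a (Suc n) (m + 1) x * deriv (tau A B a (Suc n) (m - 1)) x" for n m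
  proof -
    have "((\<lambda>x. tau A B a (Suc (Suc n)) m x * tau A B a n m x) has_field_derivative
        (deriv (tau A B a (Suc (Suc n)) m) x * tau A B a n m x +
         deriv (tau A B a n m) x * tau A B a (Suc (Suc n)) m x)) (at x)"
      by (rule DERIV_mult[OF D D])
    moreover have "((\<lambda>x. tau A B a (Suc n) m x * tau A B a (Suc n) m x
          - tau A B a (Suc n) (m + 1) x * tau A B a (Suc n) (m - 1) x) has_field_derivative
        (deriv (tau A B a (Suc n) m) x * tau A B a (Suc n) m x +
         deriv (tau A B a (Suc n) m) x * tau A B a (Suc n) m x) -
        (deriv (tau A B a (Suc n) (m + 1)) x * tau A B a (Suc n) (m - 1) x +
         deriv (tau A B a (Suc n) (m - 1)) x * tau A B a (Suc n) (m + 1) x)) (at x)"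
      by (intro DERIV_diff DERIV_mult D)
    moreover have "(\<lambda>x. tau A B a (Suc (Suc n)) m x * tau A B a n m x) =
       (\<lambda>x. tau A B a (Suc n) m x * tau A B a (Suc n) m x
          - tau A B a (Suc n) (m + 1) x * tau A B a (Suc n) (m - 1) x)"
      by (simp add: tau_toda power2_eq_square)
    ultimately show ?thesis
      using DERIV_unique by (fastforce simp: mult_ac)
  qed
  have tau1: "tau A B a 1 m = bessel_seq A B a m" for m
    by (simp add: fun_eq_iff)
  show "x * (tau A B a 1 (m - 1) x + tau A B a 1 (m + 1) x) =
      2 * (a + of_int m) * tau A B a 1 m x" for m
    unfolding tau1 by (rule bessel_seq_recurrence) fact
  show "x * deriv (tau A B a 1 m) x = x * tau A B a 1 (m - 1) x - (a + of_int m) * tau A B a 1 m x" for m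
    unfolding tau1 using DERIV_imp_deriv[OF bessel_seq_deriv[OF x, of A B a m]] \<open>x \<noteq> 0\<close>
    by (simp add: right_diff_distrib)
qed simp

definition bessel_ratio :: "complex \<Rightarrow> complex \<Rightarrow> complex \<Rightarrow> nat \<Rightarrow> complex \<Rightarrow> complex" where
  "bessel_ratio A B a n x = - (tau A B a (Suc n) (-1) x * tau A B a n 0 x) /
     (tau A B a (Suc n) 0 x * tau A B a n (-1) x)"

text \<open>
  The second unknown of the first-order system: with $u$ = \<open>bessel_ratio\<close> and $W$ = \<open>bessel_aux\<close> one has
  $x u' = -2uW - xu^2 - x - (2a+2n+1)u$ and $W' = uW - (W+2n+2)/u$, and eliminating $W$ gives Painleve III.
\<close>

definition bessel_aux :: "complex \<Rightarrow> complex \<Rightarrow> complex \<Rightarrow> nat \<Rightarrow> complex \<Rightarrow> complex" where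
  "bessel_aux A B a n x = x * tau A B a (Suc (Suc n)) 0 x * tau A B a n (-1) x /
     (tau A B a (Suc n) 0 x * tau A B a (Suc n) (-1) x)"

section \<open>No determinant vanishes identically\<close>

locale bessel_tau =
  fixes A B a :: complex
  assumes nonint: "a \<notin> \<int>" and nontrivial: "A \<noteq> 0 \<or> B \<noteq> 0"
begin

abbreviation T :: "nat \<Rightarrow> int \<Rightarrow> complex \<Rightarrow> complex" where
  "T \<equiv> tau A B a"

abbreviation T' :: "nat \<Rightarrow> int \<Rightarrow> complex \<Rightarrow> complex" where
  "T' n m \<equiv> deriv (T n m)"

text \<open>If one member of the sequence vanished identically, the derivative rule would pass this
  on to \<open>m - 1\<close> and the three-term recurrence to \<open>m + 1\<close>, hence to every
  order. The behaviour at the origin for large positive orders then gives \<open>B = 0\<close>, and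
  for large negative orders \<open>A = 0\<close>.\<close>

lemma bessel_seq_not_identically_0: "\<exists>x\<in>slit_plane. bessel_seq A B a m x \<noteq> 0"
proof (rule ccontr)
  let ?Z = "\<lambda>m. \<forall>x\<in>slit_plane. bessel_seq A B a m x = 0"
  assume "\<not> ?thesis"
  hence Z: "?Z m" by blast
  have down: "?Z (m - 1)" if "?Z m" for m
  proof
    fix x assume x: "x \<in> slit_plane"
    have "((\<lambda>_. 0) has_field_derivative
        (bessel_seq A B a (m - 1) x - (a + of_int m) / x * bessel_seq A B a m x)) (at x)"
      by (rule has_field_derivative_transform_within_open[OF bessel_seq_deriv[OF x] open_slit_plane x])
         (use that in auto)
    hence "bessel_seq A B a (m - 1) x - (a + of_int m) / x * bessel_seq A B a m x = 0"
      using DERIV_unique[OF _ DERIV_const] by blast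
    thus "bessel_seq A B a (m - 1) x = 0" using that x by simp
  qed
  have up: "?Z (m + 1)" if "?Z m" for m
  proof
    fix x assume x: "x \<in> slit_plane"
    thus "bessel_seq A B a (m + 1) x = 0"
      using bessel_seq_recurrence[of x A B a m] down[OF that] that slit_plane_nonzero[OF x] by auto
  qed
  have all: "?Z k" for k
    using up down by (induction k rule: int_induct[where k = m]) (use Z in blast)+
  have zero: "K = 0" if "leads (bessel_seq A B a k) K e" for k K e
  proof -
    have "leads (\<lambda>_. 0) K e"
      using that by (rule leads_transform) (use eventually_slit_plane all in \<open>auto elim!: eventually_mono\<close>)
    hence "((\<lambda>_. 0) \<longlongrightarrow> K) (at 0 within slit_plane)" by (simp add: leads_def)
    thus ?thesis using tendsto_unique[OF slit_filter_nontrivial _ tendsto_const] by blast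
  qed
  obtain N :: nat where N: "\<bar>Re a\<bar> < real N" using reals_Archimedean2 by blast
  have "1 - a - of_int (int N) \<notin> \<int>" "1 + a + of_int (- int N) \<notin> \<int>"
    using nonint_reflect[OF nonint, of "1 - int N"] nonint_shift[OF nonint, of "1 - int N"]
    by (simp_all add: algebra_simps)
  hence nz: "rGamma (1 - a - of_int (int N)) \<noteq> 0" "rGamma (1 + a + of_int (- int N)) \<noteq> 0"
    by (simp_all only: rGamma_nonint not_False_eq_True)
  have "B * (-1) powi (int N) * rGamma (1 - a - of_int (int N)) = 0"
    using N by (intro zero[OF bessel_seq_leads_neg]) auto
  hence "B = 0" using nz by simp
  moreover have "A * rGamma (1 + a + of_int (- int N)) = 0"
    using N by (intro zero[OF bessel_seq_leads_pos]) auto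
  hence "A = 0" using nz by simp
  ultimately show False using nontrivial by blast
qed

definition singular_set :: "nat \<Rightarrow> complex set" where
  "singular_set n = (\<Union>k\<in>{..n}. \<Union>m. {x \<in> slit_plane. T k m x = 0})"

lemma nonzero_outside_singular_set:
  "x \<in> slit_plane \<Longrightarrow> x \<notin> singular_set n \<Longrightarrow> k \<le> n \<Longrightarrow> T k m x \<noteq> 0"
  unfolding singular_set_def by blast

lemma countable_singular_setI:
  assumes "\<And>k m. k \<le> n \<Longrightarrow> \<exists>x\<in>slit_plane. T k m x \<noteq> 0"
  shows "countable (singular_set n)"
proof -
  have "countable {x \<in> slit_plane. T k m x = 0}" if "k \<le> n" for k m
    using assms[OF that, of m] countable_slit_plane_zeros[OF tau_holomorphic] by metis
  thus ?thesis unfolding singular_set_def by (intro countable_UN) auto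
qed

text \<open>
  If \<open>T (n+2) m\<close> vanished identically, so would its derivative, contradicting \<open>no_double_zero\<close> at any point
  where the smaller determinants do not vanish.
\<close>

lemma tau_not_identically_0: "\<exists>x\<in>slit_plane. T n m x \<noteq> 0"
proof (induction n arbitrary: m rule: less_induct)
  case (less n)
  consider "n = 0" | "n = Suc 0" | l where "n = Suc (Suc l)"
    by (metis not0_implies_Suc)
  thus ?case
  proof cases
    case 1
    have "(1 :: complex) \<in> slit_plane" by (simp add: slit_plane_eq_Collect)
    thus ?thesis using 1 by auto
  next
    case 2
    thus ?thesis using bessel_seq_not_identically_0 by simp
  next
    case 3
    show ?thesis
    proof (rule ccontr)
      assume "\<not> ?thesis"
      hence zero: "T (Suc (Suc l)) m x = 0" if "x \<in> slit_plane" for x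
        using 3 that by blast
      have "countable (singular_set (Suc l))"
        using less.IH 3 by (intro countable_singular_setI) auto
      then obtain x where x: "x \<in> slit_plane" "x \<notin> singular_set (Suc l)"
        using uncountable_slit_plane_minus
        by (metis Diff_eq_empty_iff countable_empty subsetI)
      interpret bessel_toda "\<lambda>n m. T n m x" "\<lambda>n m. T' n m x" x a
        by (rule bessel_toda_tau[OF x(1)])
      have "((\<lambda>_. 0) has_field_derivative T' (Suc (Suc l)) m x) (at x)"
        by (rule has_field_derivative_transform_within_open[OF tau_has_deriv[OF x(1)] open_slit_plane x(1)])
           (use zero in auto)
      hence "T' (Suc (Suc l)) m x = 0" using DERIV_unique[OF _ DERIV_const] by blast
      thus False
        using no_double_zero[of l m] zero[OF x(1)] nonzero_outside_singular_set[OF x] by blast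
    qed
  qed
qed

lemma countable_singular_set: "countable (singular_set n)"
  using tau_not_identically_0 by (intro countable_singular_setI)

lemma deriv_tau_holomorphic [holomorphic_intros]: "T' n m holomorphic_on slit_plane"
  by (intro holomorphic_deriv tau_holomorphic open_slit_plane)

lemma tau_shift2:
  assumes "x \<in> slit_plane"
  shows "x * (T (Suc (Suc n)) m x * T n (m - 1) x - T (Suc (Suc n)) (m - 1) x * T n m x) =
    - 2 * of_nat (Suc n) * T (Suc n) m x * T (Suc n) (m - 1) x"
  by (rule slit_plane_identity[OF _ _ countable_singular_set[of n] _ assms];
      (intro holomorphic_intros)?)
     (use bessel_toda.shift_identities[OF bessel_toda_tau] nonzero_outside_singular_set
       in \<open>fastforce simp: bessel_toda.shift2_def[OF bessel_toda_tau]\<close>)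

lemma tau_shift1:
  assumes "x \<in> slit_plane"
  shows "x * (T (Suc n) (m - 1) x * T n (m + 1) x + T (Suc n) (m + 1) x * T n (m - 1) x) =
     2 * (a + of_int m) * T (Suc n) m x * T n m x"
  by (rule slit_plane_identity[OF _ _ countable_singular_set[of n] _ assms];
      (intro holomorphic_intros)?)
     (use bessel_toda.shift_identities[OF bessel_toda_tau] nonzero_outside_singular_set
       in \<open>fastforce simp: bessel_toda.shift1_def[OF bessel_toda_tau]\<close>)

lemma tau_wronskian:
  assumes "x \<in> slit_plane"
  shows "x * (T' (Suc n) m x * T n m x - T (Suc n) m x * T' n m x) =
     x * T (Suc n) (m - 1) x * T n (m + 1) x - (a + of_int m) * T (Suc n) m x * T n m x"
  by (rule slit_plane_identity[OF _ _ countable_singular_set[of n] _ assms];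
      (intro holomorphic_intros)?)
     (use bessel_toda.wronskian_identities[OF bessel_toda_tau] nonzero_outside_singular_set
       in \<open>fastforce simp: bessel_toda.wronskian_n_def[OF bessel_toda_tau]\<close>)


section \<open>The first-order system for \<open>u\<close> and \<open>W\<close>\<close>

abbreviation u :: "nat \<Rightarrow> complex \<Rightarrow> complex" where
  "u \<equiv> bessel_ratio A B a"

abbreviation W :: "nat \<Rightarrow> complex \<Rightarrow> complex" where
  "W \<equiv> bessel_aux A B a"

text \<open>As division by zero yields 0, the single condition \<open>u n x \<noteq> 0\<close>
  encodes that neither numerator nor denominator vanishes.\<close>

lemma bessel_ratio_nonzeroD:
  assumes "u n x \<noteq> 0"
  shows "T n 0 x \<noteq> 0" "T n (-1) x \<noteq> 0" "T (Suc n) 0 x \<noteq> 0" "T (Suc n) (-1) x \<noteq> 0"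
  using assms by (auto simp: bessel_ratio_def)

text \<open>These relations close the system. The logarithmic derivative of \<open>u n\<close>
  contains determinants at m = -2 and m = 1, which occur in neither \<open>u n\<close> nor
  \<open>W n\<close>; the bilinear identities and the Toda equation express the quotients in
  question by \<open>u n x\<close>, \<open>W n x\<close> and \<open>x\<close>.\<close>

lemma
  assumes x: "x \<in> slit_plane" and u: "u n x \<noteq> 0"
  shows quotient_minus: "T (Suc n) (-2) x * T n 0 x / (T (Suc n) (-1) x * T n (-1) x) =
      - u n x - (W n x + 2 * of_nat (Suc n)) / x" (is ?th1)
    and quotient_plus: "T (Suc n) (-1) x * T n 1 x / (T (Suc n) 0 x * T n 0 x) =
      W n x / x + 1 / u n x + 2 * a / x" (is ?th2)
    and bessel_aux_plus: "W n x + 2 * of_nat (Suc n) =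
      x * T (Suc (Suc n)) (-1) x * T n 0 x / (T (Suc n) 0 x * T (Suc n) (-1) x)" (is ?th3)
proof -
  define p p1 pm where "p = T n 0 x" "p1 = T n 1 x" "pm = T n (-1) x"
  define q q1 qm qmm where "q = T (Suc n) 0 x" "q1 = T (Suc n) 1 x" "qm = T (Suc n) (-1) x"
    "qmm = T (Suc n) (-2) x"
  define r rm where "r = T (Suc (Suc n)) 0 x" "rm = T (Suc (Suc n)) (-1) x"
  define N :: complex where "N = of_nat (Suc n)"
  note defs = p_p1_pm_def q_q1_qm_qmm_def r_rm_def N_def
  have nz: "p \<noteq> 0" "pm \<noteq> 0" "q \<noteq> 0" "qm \<noteq> 0" "x \<noteq> 0"
    using bessel_ratio_nonzeroD[OF u] slit_plane_nonzero[OF x] by (auto simp: defs)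
  have ueq: "u n x = - (qm * p) / (q * pm)" and Weq: "W n x = x * r * pm / (q * qm)"
    by (simp_all add: bessel_ratio_def bessel_aux_def defs)
  have h1: "x * (r * pm - rm * p) = - 2 * N * q * qm"
    using tau_shift2[OF x, of n 0] by (simp add: defs)
  have h2: "x * (qm * p1 + q1 * pm) = 2 * a * q * p"
    using tau_shift1[OF x, of n 0] by (simp add: defs)
  have h3: "r * p = q\<^sup>2 - q1 * qm"
    using tau_toda[of A B a n 0 x] by (simp add: defs)
  have h4: "rm * pm = qm\<^sup>2 - q * qmm"
    using tau_toda[of A B a n "-1" x] by (simp add: defs)
  have "W n x + 2 * N = (x * r * pm + 2 * N * q * qm) / (q * qm)"
    using nz by (simp add: Weq field_simps)
  also have "x * r * pm + 2 * N * q * qm = x * rm * p"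
    using h1 by (simp add: algebra_simps)
  finally have W2: "W n x + 2 * N = x * rm * p / (q * qm)" .
  thus ?th3 by (simp add: defs)
  have "qmm * p / (qm * pm) = (q * qmm) * p / (q * qm * pm)"
    using nz by simp
  also have "q * qmm = qm\<^sup>2 - rm * pm" using h4 by simp
  also have "(qm\<^sup>2 - rm * pm) * p / (q * qm * pm) = - u n x - (W n x + 2 * N) / x"
    unfolding W2 using nz by (simp add: ueq field_simps power2_eq_square)
  finally show ?th1 by (simp add: defs)
  have "qm * p1 / (q * p) = (x * (qm * p1)) / (x * q * p)"
    using nz by simp
  also have "x * (qm * p1) = 2 * a * q * p - x * q1 * pm"
    using h2 by (simp add: algebra_simps)
  also have "(2 * a * q * p - x * q1 * pm) / (x * q * p) = 2 * a / x - (q1 * qm) * pm / (q * p * qm)"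
    using nz by (simp add: field_simps)
  also have "q1 * qm = q\<^sup>2 - r * p" using h3 by simp
  also have "2 * a / x - (q\<^sup>2 - r * p) * pm / (q * p * qm) = W n x / x + 1 / u n x + 2 * a / x"
    using nz by (simp add: ueq Weq field_simps power2_eq_square)
  finally show ?th2 by (simp add: defs)
qed

lemma bessel_ratio_has_deriv:
  assumes x: "x \<in> slit_plane" and u: "u n x \<noteq> 0"
  shows "(u n has_field_derivative
    (- 2 * u n x * W n x - x * (u n x)\<^sup>2 - x - (2 * a + 2 * of_nat n + 1) * u n x) / x) (at x)"
proof -
  define p p' p1 pm pm' where "p = T n 0 x" "p' = T' n 0 x" "p1 = T n 1 x" "pm = T n (-1) x"
    "pm' = T' n (-1) x"
  define q q' qm qm' qmm where "q = T (Suc n) 0 x" "q' = T' (Suc n) 0 x" "qm = T (Suc n) (-1) x"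
    "qm' = T' (Suc n) (-1) x" "qmm = T (Suc n) (-2) x"
  note defs = p_p'_p1_pm_pm'_def q_q'_qm_qm'_qmm_def
  have nz: "p \<noteq> 0" "pm \<noteq> 0" "q \<noteq> 0" "qm \<noteq> 0" "x \<noteq> 0"
    using bessel_ratio_nonzeroD[OF u] slit_plane_nonzero[OF x] by (auto simp: defs)
  have ueq: "u n x = - (qm * p) / (q * pm)"
    by (simp add: bessel_ratio_def defs)
  have h1: "x * (qm' * pm - qm * pm') = x * qmm * p - (a - 1) * qm * pm"
    using tau_wronskian[OF x, of n "-1"] by (simp add: defs)
  have h2: "x * (q' * p - q * p') = x * qm * p1 - a * q * p"
    using tau_wronskian[OF x, of n 0] by (simp add: defs)
  have "(u n has_field_derivative
      - (((qm' * p + p' * qm) * (q * pm) - (qm * p) * (q' * pm + pm' * q)) / ((q * pm) * (q * pm)))) (at x)"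
    using DERIV_minus[OF DERIV_divide[OF DERIV_mult[OF tau_has_deriv[OF x, of A B a "Suc n" "-1"]
      tau_has_deriv[OF x, of A B a n 0]] DERIV_mult[OF tau_has_deriv[OF x, of A B a "Suc n" 0]
      tau_has_deriv[OF x, of A B a n "-1"]]]] nz
    unfolding bessel_ratio_def [abs_def] by (simp add: defs)
  moreover have "x * ((qm' * p + p' * qm) * (q * pm) - (qm * p) * (q' * pm + pm' * q)) =
      p * q * (x * (qm' * pm - qm * pm')) - qm * pm * (x * (q' * p - q * p'))"
    by (simp add: algebra_simps)
  hence "(qm' * p + p' * qm) * (q * pm) - (qm * p) * (q' * pm + pm' * q) =
      (p * q * (x * qmm * p - (a - 1) * qm * pm) - qm * pm * (x * qm * p1 - a * q * p)) / x"
    unfolding h1 h2 using nz by (simp add: field_simps)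
  moreover have "- ((p * q * (x * qmm * p - (a - 1) * qm * pm) - qm * pm * (x * qm * p1 - a * q * p)) / x
        / ((q * pm) * (q * pm))) =
      u n x * (qmm * p / (qm * pm) - qm * p1 / (q * p) + 1 / x)"
    using nz by (simp add: ueq field_simps)
  moreover have "qmm * p / (qm * pm) = - u n x - (W n x + 2 * of_nat (Suc n)) / x"
    using quotient_minus[OF x u] by (simp add: defs)
  moreover have "qm * p1 / (q * p) = W n x / x + 1 / u n x + 2 * a / x"
    using quotient_plus[OF x u] by (simp add: defs)
  ultimately have "(u n has_field_derivative u n x * (- u n x - (W n x + 2 * of_nat (Suc n)) / x -
      (W n x / x + 1 / u n x + 2 * a / x) + 1 / x)) (at x)"
    by simp
  also have "u n x * (- u n x - (W n x + 2 * of_nat (Suc n)) / x -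
      (W n x / x + 1 / u n x + 2 * a / x) + 1 / x) =
    (- 2 * u n x * W n x - x * (u n x)\<^sup>2 - x - (2 * a + 2 * of_nat n + 1) * u n x) / x"
    using nz u by (simp add: field_simps power2_eq_square)
  finally show ?thesis .
qed

lemma bessel_aux_has_deriv:
  assumes x: "x \<in> slit_plane" and u: "u n x \<noteq> 0"
  shows "(W n has_field_derivative
    (u n x * W n x - (W n x + 2 * of_nat (Suc n)) / u n x)) (at x)"
proof -
  define p pm pm' where "p = T n 0 x" "pm = T n (-1) x" "pm' = T' n (-1) x"
  define q q' q1 qm qm' qmm where "q = T (Suc n) 0 x" "q' = T' (Suc n) 0 x" "q1 = T (Suc n) 1 x"
    "qm = T (Suc n) (-1) x" "qm' = T' (Suc n) (-1) x" "qmm = T (Suc n) (-2) x"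
  define r r' rm where "r = T (Suc (Suc n)) 0 x" "r' = T' (Suc (Suc n)) 0 x" "rm = T (Suc (Suc n)) (-1) x"
  note defs = p_pm_pm'_def q_q'_q1_qm_qm'_qmm_def r_r'_rm_def
  have nz: "p \<noteq> 0" "pm \<noteq> 0" "q \<noteq> 0" "qm \<noteq> 0" "x \<noteq> 0"
    using bessel_ratio_nonzeroD[OF u] slit_plane_nonzero[OF x] by (auto simp: defs)
  have ueq: "u n x = - (qm * p) / (q * pm)" and Weq: "W n x = x * r * pm / (q * qm)"
    by (simp_all add: bessel_ratio_def bessel_aux_def defs)
  have W2: "W n x + 2 * of_nat (Suc n) = x * rm * p / (q * qm)"
    using bessel_aux_plus[OF x u] by (simp add: defs)
  have h1: "x * (qm' * pm - qm * pm') = x * qmm * p - (a - 1) * qm * pm"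
    using tau_wronskian[OF x, of n "-1"] by (simp add: defs)
  have h2: "x * (r' * q - r * q') = x * rm * q1 - a * r * q"
    using tau_wronskian[OF x, of "Suc n" 0] by (simp add: defs)
  have h3: "q1 * qm = q\<^sup>2 - r * p"
    using tau_toda[of A B a n 0 x] by (simp add: defs)
  have h4: "q * qmm = qm\<^sup>2 - rm * pm"
    using tau_toda[of A B a n "-1" x] by (simp add: defs)
  have "(W n has_field_derivative
      (((1 * r + r' * x) * pm + pm' * (x * r)) * (q * qm)
       - (x * r * pm) * (q' * qm + qm' * q)) / ((q * qm) * (q * qm))) (at x)"
    using DERIV_divide[OF DERIV_mult[OF DERIV_mult[OF DERIV_ident
      tau_has_deriv[OF x, of A B a "Suc (Suc n)" 0]] tau_has_deriv[OF x, of A B a n "-1"]]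
      DERIV_mult[OF tau_has_deriv[OF x, of A B a "Suc n" 0] tau_has_deriv[OF x, of A B a "Suc n" "-1"]]] nz
    unfolding bessel_aux_def [abs_def] by (simp add: defs)
  also have "((1 * r + r' * x) * pm + pm' * (x * r)) * (q * qm)
       - (x * r * pm) * (q' * qm + qm' * q) =
      r * pm * q * qm + pm * qm * (x * (r' * q - r * q')) - r * q * (x * (qm' * pm - qm * pm'))"
    by (simp add: algebra_simps)
  \<comment> \<open>The terms in \<open>r * pm * q * qm\<close> have coefficients 1, -a and a - 1
    and cancel. The 1 stems from the prefactor \<open>x\<close> in
    \<open>bessel_aux\<close>.\<close>
  also have "r * pm * q * qm + pm * qm * (x * (r' * q - r * q')) - r * q * (x * (qm' * pm - qm * pm')) =
      x * (pm * rm * (q1 * qm) - r * p * (q * qmm))"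
    unfolding h1 h2 by (simp add: algebra_simps)
  also have "\<dots> = x * (pm * rm * q\<^sup>2 - r * p * qm\<^sup>2)"
    unfolding h3 h4 by (simp add: algebra_simps)
  also have "\<dots> / ((q * qm) * (q * qm)) = u n x * W n x - (W n x + 2 * of_nat (Suc n)) / u n x"
    unfolding W2 unfolding ueq Weq using nz by (simp add: field_simps power2_eq_square)
  finally show ?thesis .
qed

text \<open>Under the convention for division \<open>u n\<close> takes the value 0 at its poles and
  need not be continuous there. Openness is therefore taken from the product of the four
  determinants.\<close>

lemma bessel_ratio_nonzero_nhds:
  assumes "x \<in> slit_plane" "u n x \<noteq> 0"
  obtains U where "open U" "x \<in> U" "U \<subseteq> slit_plane" "\<And>y. y \<in> U \<Longrightarrow> u n y \<noteq> 0"
proof -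
  define g where "g = (\<lambda>y. T n 0 y * T n (-1) y * T (Suc n) 0 y * T (Suc n) (-1) y)"
  have "g holomorphic_on slit_plane"
    unfolding g_def by (intro holomorphic_intros)
  hence "open (slit_plane \<inter> g -` (- {0}))"
    using holomorphic_on_imp_continuous_on open_slit_plane
    by (intro continuous_open_preimage) auto
  moreover have "x \<in> slit_plane \<inter> g -` (- {0})"
    using assms bessel_ratio_nonzeroD[OF assms(2)] by (simp add: g_def)
  moreover have "u n y \<noteq> 0" if "y \<in> slit_plane \<inter> g -` (- {0})" for y
    using that by (simp add: g_def bessel_ratio_def)
  ultimately show ?thesis using that by blast
qed

theorem bessel_ratio_Painleve_III:
  "solves_Painleve_III (2 * a + 2 * of_nat n) (- 2 * a + 2 + 2 * of_nat n) (u n) slit_plane"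
  unfolding solves_Painleve_III_def
proof (intro ballI impI)
  fix x assume x: "x \<in> slit_plane" and ux: "u n x \<noteq> 0"
  define v where "v = (\<lambda>y. (- 2 * u n y * W n y - y * (u n y)\<^sup>2 - y - (2 * a + 2 * of_nat n + 1) * u n y) / y)"
  from bessel_ratio_nonzero_nhds[OF x ux] obtain U where
    U: "open U" "x \<in> U" "U \<subseteq> slit_plane" "\<And>y. y \<in> U \<Longrightarrow> u n y \<noteq> 0" by blast
  have du: "(u n has_field_derivative v y) (at y)" if "y \<in> U" for y
    using bessel_ratio_has_deriv[of y n] U that unfolding v_def by blast
  have "u n holomorphic_on U"
    unfolding holomorphic_on_def field_differentiable_def using du DERIV_subset by blast
  hence analytic: "u n analytic_on {x}"
    using U analytic_at by blast
  have dv: "deriv (u n) y = v y" if "y \<in> U" for y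
    using du[OF that] by (rule DERIV_imp_deriv)
  define y w where "y = u n x" and "w = W n x"
  define k where "k = 2 * a + 2 * of_nat n + (1 :: complex)"
  define N :: complex where "N = of_nat (Suc n)"
  have nz: "x \<noteq> 0" "y \<noteq> 0" using slit_plane_nonzero[OF x] ux by (auto simp: y_def)
  have v: "v x = (- 2 * y * w - x * y\<^sup>2 - x - k * y) / x"
    by (simp add: v_def y_def w_def k_def)
  define s where "s = (w + 2 * N) / y"
  have dW: "(W n has_field_derivative (y * w - s)) (at x)"
    using bessel_aux_has_deriv[OF x ux] by (simp add: y_def w_def N_def s_def)
  define z where "z = v x"
  have du_x: "(u n has_field_derivative z) (at x)"
    using du[OF U(2)] by (simp add: z_def)
  have "(v has_field_derivative
      ((- 2 * (z * w + (y * w - s) * y) - (y\<^sup>2 + 2 * y * z * x) - 1 - k * z) * x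
        - (- 2 * y * w - x * y\<^sup>2 - x - k * y)) / (x * x)) (at x)"
    unfolding v_def k_def [symmetric] using nz
    by (auto intro!: derivative_eq_intros du_x dW
      simp: y_def [symmetric] w_def [symmetric] algebra_simps)
  from DERIV_imp_deriv[OF has_field_derivative_transform_within_open[OF this U(1,2) dv [symmetric]]]
  have "deriv (deriv (u n)) x =
      ((- 2 * (z * w + (y * w - s) * y) - (y\<^sup>2 + 2 * y * z * x) - 1 - k * z) * x
        - (- 2 * y * w - x * y\<^sup>2 - x - k * y)) / (x * x)"
    by simp
  also have "\<dots> = (v x)\<^sup>2 / y - v x / x +
      ((k - 1) * y\<^sup>2 + (4 * N - 1 - k)) / x + y ^ 3 - 1 / y"
  proof -
    define c where "c = - 2 * (z * w + (y * w - s) * y) - (y\<^sup>2 + 2 * y * z * x) - 1 - k * z"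
    have xz: "- 2 * y * w - x * y\<^sup>2 - x - k * y = x * z"
      using nz by (simp add: z_def v)
    \<comment> \<open>The first-order equation for \<open>u\<close> is solved for \<open>w\<close>.
      Because \<open>s * y = w + 2 * N\<close>, the expression \<open>c\<close> is linear in
      \<open>w\<close>, so substituting this eliminates \<open>w\<close> altogether.\<close>
    have "- 2 * w = (- 2 * y * w) / y" using nz by simp
    also have "- 2 * y * w = x * z + x * y\<^sup>2 + x + k * y"
      using xz by (simp add: algebra_simps)
    also have "\<dots> / y = x * z / y + x * y + x / y + k"
      using nz by (simp add: add_divide_distrib power2_eq_square)
    finally have w2: "- 2 * w = x * z / y + x * y + x / y + k" .
    have "s * y = w + 2 * N" using nz by (simp add: s_def)
    hence "c = (z + y\<^sup>2 - 1) * (- 2 * w) + 4 * N - y\<^sup>2 - 2 * y * z * x - 1 - k * z"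
      unfolding c_def by (simp add: algebra_simps power2_eq_square)
    also have "\<dots> = x * (z\<^sup>2 / y) + x * y ^ 3 - x * (1 / y) + ((k - 1) * y\<^sup>2 + (4 * N - 1 - k))"
      unfolding w2 using nz
      by (simp add: algebra_simps power2_eq_square power3_eq_cube add_divide_distrib diff_divide_distrib)
    finally have c: "c = \<dots>" .
    have "(c * x - x * z) / (x * x) = c / x - z / x"
      using nz by (simp add: diff_divide_distrib)
    also have "\<dots> = z\<^sup>2 / y - z / x + ((k - 1) * y\<^sup>2 + (4 * N - 1 - k)) / x + y ^ 3 - 1 / y"
      unfolding c using nz by (simp add: add_divide_distrib diff_divide_distrib)
    finally show ?thesis
      unfolding xz c_def z_def .
  qed
  finally have "deriv (deriv (u n)) x = (v x)\<^sup>2 / y - v x / x +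
      ((k - 1) * y\<^sup>2 + (4 * N - 1 - k)) / x + y ^ 3 - 1 / y" .
  moreover have "4 * N - 1 - k = - 2 * a + 2 + 2 * of_nat n" "k - 1 = 2 * a + 2 * of_nat n"
    by (simp_all add: k_def N_def)
  ultimately show "u n analytic_on {x} \<and> deriv (deriv (u n)) x =
      (deriv (u n) x)\<^sup>2 / u n x - deriv (u n) x / x +
      ((2 * a + 2 * of_nat n) * (u n x)\<^sup>2 + (- 2 * a + 2 + 2 * of_nat n)) / x + u n x ^ 3 - 1 / u n x"
    using analytic unfolding dv[OF U(2)] y_def by simp
qed

end

section \<open>Recursion in $n$ for the leading behaviour\<close>

text \<open>Negating all orders exchanges \<open>A\<close> and \<open>B\<close>; transposition
  undoes the reversal of indices, and the alternating signs scale out of rows and columns. The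
  further shift from -a to 1 - a, which flips one sign, makes the reflection swap m = 0 and m = -1,
  so that it acts on \<open>u\<close> by inversion.\<close>

lemma tau_reflect:
  "tau A B a n m x = ((-1) powi m) ^ n * tau B (- A) (1 - a) n (- m - 1) x"
proof -
  define s where "s = ((-1) powi m :: complex)"
  have ss: "s * s = 1" by (simp add: s_def power_int_minus_left)
  have signs: "(-1) powi (m + int j - int k) = s * ((-1) ^ j * (-1) ^ k :: complex)" for j k
    by (simp add: s_def power_int_minus_left minus_one_power_iff)
  have "tau B A (- a) n (- m) x =
      fdet n (\<lambda>j k. bessel_seq B A (- a) (- (m + int j - int k)) x)"
    by (simp add: tau_def algebra_simps)
  also have "\<dots> = fdet n (\<lambda>j k. s * ((-1) ^ j * ((-1) ^ k * bessel_seq A B a (m + int j - int k) x)))"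
    unfolding bessel_seq_reflect signs by (simp add: mult.assoc)
  also have "\<dots> = s ^ n * ((\<Prod>j<n. (-1) ^ j) * ((\<Prod>k<n. (-1) ^ k) *
      fdet n (\<lambda>j k. bessel_seq A B a (m + int j - int k) x)))"
    by (simp only: fdet_scale_rows fdet_scale_columns) simp
  also have "fdet n (\<lambda>j k. bessel_seq A B a (m + int j - int k) x) = tau A B a n m x"
    using fdet_transpose[of n "\<lambda>j k. bessel_seq A B a (m - int j + int k) x"]
    by (simp add: tau_def algebra_simps)
  also have "(\<Prod>j<n. (-1) ^ j) * ((\<Prod>k<n. (-1) ^ k) * tau A B a n m x) = tau A B a n m x"
    by (simp flip: mult.assoc prod.distrib power_mult_distrib)
  finally have 1: "tau B A (- a) n (- m) x = s ^ n * tau A B a n m x" .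
  have "s ^ n * tau B A (- a) n (- m) x = (s * s) ^ n * tau A B a n m x"
    unfolding 1 by (simp add: power_mult_distrib mult.assoc)
  hence "tau A B a n m x = s ^ n * tau B A (- a) n (- m) x" by (simp add: ss)
  also have "tau B A (- a) n (- m) x = tau B (- A) (1 - a) n (- m - 1) x"
    using tau_shift[of B A "- a" n 1 "- m - 1" x] by simp
  finally show ?thesis by (simp add: s_def)
qed

lemma bessel_ratio_reflect:
  "bessel_ratio A B a n x = - 1 / bessel_ratio B (- A) (1 - a) n x"
  unfolding bessel_ratio_def tau_reflect[of A B a n 0] tau_reflect[of A B a n "-1"]
    tau_reflect[of A B a "Suc n" 0] tau_reflect[of A B a "Suc n" "-1"]
  by (simp add: power_int_minus)

text \<open>Reflection turns the numerator of \<open>bessel_aux\<close> into that of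
  \<open>bessel_aux_plus\<close>, which accounts for the additional constant.\<close>

lemma bessel_aux_reflect:
  assumes "bessel_tau A B a" "x \<in> slit_plane" "bessel_ratio B (- A) (1 - a) n x \<noteq> 0"
  shows "bessel_aux A B a n x = - (bessel_aux B (- A) (1 - a) n x + 2 * of_nat (Suc n))"
proof -
  interpret bessel_tau A B a by fact
  interpret hat: bessel_tau B "- A" "1 - a"
    using nonint_reflect[OF nonint, of 1] nontrivial by unfold_locales auto
  show ?thesis
    unfolding hat.bessel_aux_plus[OF assms(2,3)]
    unfolding bessel_aux_def tau_reflect[of A B a n "-1"]
      tau_reflect[of A B a "Suc n" 0] tau_reflect[of A B a "Suc n" "-1"]
      tau_reflect[of A B a "Suc (Suc n)" 0]
    by (simp add: power_int_minus mult_ac)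
qed

text \<open>The reflection product $\<Gamma>(a) \<Gamma>(1 - a)$ changes sign under a unit shift of
  \<open>a\<close>. The functional equation alone gives this.\<close>

lemma rGamma_reflect_int:
  "(-1) ^ n * rGamma (a - of_nat n) * rGamma (of_nat n + 1 - a) = rGamma a * rGamma (1 - a)"
  for a :: complex
proof (induction n)
  case (Suc n)
  define t where "t = a - of_nat (Suc n)"
  have "rGamma (a - of_nat (Suc n)) = t * rGamma (a - of_nat n)"
    using rGamma_plus1[of t] by (simp add: t_def)
  moreover have "rGamma (of_nat n + 1 - a) = (- t) * rGamma (of_nat (Suc n) + 1 - a)"
    using rGamma_plus1[of "- t"] by (simp add: t_def algebra_simps)
  ultimately show ?case
    using Suc.IH by (simp add: mult_ac)
qed simp

lemma nonint_shift_nat: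
  assumes "a \<notin> (\<int> :: complex set)"
  shows "a + of_nat k \<notin> \<int>" "a - of_nat k \<notin> \<int>" "of_nat k - a \<notin> \<int>"
  using nonint_shift[OF assms, of "int k"] nonint_shift[OF assms, of "- int k"]
    nonint_reflect[OF assms, of "int k"] by simp_all

lemma nonint_nonzero: "z \<notin> (\<int> :: complex set) \<Longrightarrow> z \<noteq> 0"
  using Ints_0 by metis

section \<open>One step of the recursion, and the strips where it starts\<close>

context bessel_tau
begin

lemma bessel_ratio_Suc:
  assumes x: "x \<in> slit_plane" and u: "u n x \<noteq> 0" and W: "W n x \<noteq> 0"
  shows "u (Suc n) x = (W n x + 2 * of_nat (Suc n)) / (W n x * u n x)"
proof -
  have "T (Suc (Suc n)) 0 x \<noteq> 0"
    using W by (auto simp: bessel_aux_def)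
  thus ?thesis
    unfolding bessel_aux_plus[OF x u]
    using bessel_ratio_nonzeroD[OF u] slit_plane_nonzero[OF x]
    by (simp add: bessel_ratio_def bessel_aux_def field_simps)
qed

lemma bessel_aux_Suc:
  assumes x: "x \<in> slit_plane" and u: "u (Suc n) x \<noteq> 0"
  shows "W (Suc n) x = - W n x - x * (u (Suc n) x + 1 / u (Suc n) x) - 2 * a - 2 * of_nat (Suc n)"
proof -
  define p pm where "p = T n 0 x" "pm = T n (-1) x"
  define q q1 qm where "q = T (Suc n) 0 x" "q1 = T (Suc n) 1 x" "qm = T (Suc n) (-1) x"
  define r rm where "r = T (Suc (Suc n)) 0 x" "rm = T (Suc (Suc n)) (-1) x"
  define N :: complex where "N = of_nat (Suc n)"
  note defs = p_pm_def q_q1_qm_def r_rm_def N_def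
  have nz: "q \<noteq> 0" "qm \<noteq> 0" "r \<noteq> 0" "rm \<noteq> 0" "x \<noteq> 0"
    using bessel_ratio_nonzeroD[OF u] slit_plane_nonzero[OF x] by (auto simp: defs)
  have ueq: "u (Suc n) x = - (rm * q) / (r * qm)" and Weq: "W n x = x * r * pm / (q * qm)"
    by (simp_all add: bessel_ratio_def bessel_aux_def defs)
  have h1: "x * (r * pm - rm * p) = - 2 * N * q * qm"
    using tau_shift2[OF x, of n 0] by (simp add: defs)
  have h2: "r * p = q\<^sup>2 - q1 * qm"
    using tau_toda[of A B a n 0 x] by (simp add: defs)
  have "W n x = (x * rm * p - 2 * N * q * qm) / (q * qm)"
    using h1 by (simp add: Weq algebra_simps)
  also have "\<dots> = x * rm * (r * p) / (r * q * qm) - 2 * N"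
    using nz by (simp add: field_simps)
  also have "\<dots> = - x * u (Suc n) x - x * (rm * q1 / (r * q)) - 2 * N"
    unfolding h2 ueq using nz by (simp add: field_simps power2_eq_square)
  also have "rm * q1 / (r * q) = W (Suc n) x / x + 1 / u (Suc n) x + 2 * a / x"
    using quotient_plus[OF x u] by (simp add: defs)
  finally have "W n x = - x * u (Suc n) x - x * (W (Suc n) x / x + 1 / u (Suc n) x + 2 * a / x) - 2 * N" .
  thus ?thesis
    using nz by (simp add: ring_distribs N_def)
qed

text \<open>The bounds on \<open>Re e\<close> are what makes both \<open>x * u (Suc n) x\<close> and
  \<open>x / u (Suc n) x\<close> tend to 0, so the recursion for \<open>W\<close> passes to the
  limit.\<close>

lemma ratio_leads_Suc:
  assumes u: "leads (u n) K e" and K: "K \<noteq> 0" and e: "- 1 < Re e" "Re e < 1"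
    and W: "(W n \<longlongrightarrow> w) (at 0 within slit_plane)"
    and w: "w \<noteq> 0" "w + 2 * of_nat (Suc n) \<noteq> 0"
  shows "leads (u (Suc n)) ((w + 2 * of_nat (Suc n)) / (w * K)) (- e)"
    and "(W (Suc n) \<longlongrightarrow> - w - 2 * a - 2 * of_nat (Suc n)) (at 0 within slit_plane)"
proof -
  let ?F = "at 0 within slit_plane :: complex filter"
  have W': "leads (W n) w 0" using W by (simp add: leads_0_iff)
  have ev: "\<forall>\<^sub>F x in ?F. x \<in> slit_plane \<and> u n x \<noteq> 0 \<and> W n x \<noteq> 0"
    using eventually_slit_plane leads_nonzero[OF u K] leads_nonzero[OF W' w(1)]
    by eventually_elim blast
  have "leads (\<lambda>x. (W n x + 2 * of_nat (Suc n)) / (W n x * u n x))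
      ((w + 2 * of_nat (Suc n)) / (w * K)) (0 - (0 + e))"
    using w K by (intro leads_divide leads_add leads_mult u W' leads_const) auto
  moreover have "\<forall>\<^sub>F x in ?F. (W n x + 2 * of_nat (Suc n)) / (W n x * u n x) = u (Suc n) x"
    using ev by eventually_elim (simp add: bessel_ratio_Suc)
  ultimately have "leads (u (Suc n)) ((w + 2 * of_nat (Suc n)) / (w * K)) (0 - (0 + e))"
    by (rule leads_transform)
  thus u': "leads (u (Suc n)) ((w + 2 * of_nat (Suc n)) / (w * K)) (- e)" by simp
  define L where "L = (w + 2 * of_nat (Suc n)) / (w * K)"
  have L: "L \<noteq> 0" using w K by (simp add: L_def)
  have u': "leads (u (Suc n)) L (- e)" using u' by (simp add: L_def)
  have "leads (\<lambda>x. x * u (Suc n) x) 0 0"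
    by (rule leads_higher[OF leads_mult[OF leads_id u']]) (use e in simp)
  moreover have "leads (\<lambda>x. x / u (Suc n) x) 0 0"
    by (rule leads_higher[OF leads_divide[OF leads_id u' L]]) (use e in simp)
  ultimately have "((\<lambda>x. - W n x - (x * u (Suc n) x + x / u (Suc n) x) - 2 * a - 2 * of_nat (Suc n))
      \<longlongrightarrow> - w - (0 + 0) - 2 * a - 2 * of_nat (Suc n)) ?F"
    using W unfolding leads_0_iff by (intro tendsto_intros)
  moreover have "\<forall>\<^sub>F x in ?F. - W n x - (x * u (Suc n) x + x / u (Suc n) x) - 2 * a - 2 * of_nat (Suc n) =
      W (Suc n) x"
    using eventually_slit_plane leads_nonzero[OF u' L]
    by eventually_elim (simp add: bessel_aux_Suc ring_distribs)
  ultimately show "(W (Suc n) \<longlongrightarrow> - w - 2 * a - 2 * of_nat (Suc n)) ?F"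
    using Lim_transform_eventually by fastforce
qed

lemma kappa_m1: "kappa B a n (-1) * rGamma (1 - a) = (-1) ^ n * kappa B a n 0 * rGamma (of_nat n + 1 - a)"
  using rGamma_prod_shift[of n "a - 1"]
  by (simp add: kappa_def power_minus[of B] algebra_simps)

lemma tau_m1_0_leads:
  assumes "B \<noteq> 0" "A = 0 \<or> Re a > real n"
  shows "leads (T n 0) (kappa B a n 0) (- of_nat n * a)"
    and "leads (T n (-1)) (kappa B a n (-1)) (- of_nat n * (a - 1))"
  using tau_leads_neg[OF nonint assms(1), of A n 0] tau_leads_neg[OF nonint assms(1), of A n "-1"] assms(2)
  by auto

lemma ratio_leads_right:
  assumes B: "B \<noteq> 0" and dominant: "A = 0 \<or> Re a > real n + 1"
  shows "leads (u n) (1 / (of_nat n + 1 - a)) 1"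
proof -
  let ?k = "\<lambda>n m. kappa B a n m"
  define t where "t = of_nat n + 1 - a"
  have "leads (\<lambda>x. - 1 * (T (Suc n) (-1) x * T n 0 x) / (T (Suc n) 0 x * T n (-1) x))
      (- 1 * (?k (Suc n) (-1) * ?k n 0) / (?k (Suc n) 0 * ?k n (-1)))
      ((- of_nat (Suc n) * (a - 1) + - of_nat n * a) - (- of_nat (Suc n) * a + - of_nat n * (a - 1)))"
    using dominant kappa_nonzero[OF B nonint]
    by (intro leads_divide leads_cmult leads_mult tau_m1_0_leads B) auto
  moreover have "- 1 * (?k (Suc n) (-1) * ?k n 0) / (?k (Suc n) 0 * ?k n (-1)) = 1 / t"
  proof -
    define R where "R = rGamma (1 - a)"
    define S where "S = rGamma (t + 1)"
    have t: "t \<notin> \<int>" using nonint_shift_nat(3)[OF nonint, of "Suc n"] by (simp add: t_def add.commute)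
    have R: "R \<noteq> 0" using nonint_reflect[OF nonint, of 1] rGamma_nonint by (simp add: R_def)
    have S: "S \<noteq> 0" using nonint_shift[OF t, of 1] rGamma_nonint by (simp add: S_def)
    have "?k n (-1) * R = (-1) ^ n * ?k n 0 * (t * S)"
      using kappa_m1[of n] rGamma_plus1[of t] by (simp add: t_def R_def S_def add_ac)
    hence 1: "?k n (-1) = (-1) ^ n * ?k n 0 * (t * S) / R"
      using R by (simp add: field_simps)
    have "?k (Suc n) (-1) * R = - ((-1) ^ n) * ?k (Suc n) 0 * S"
      using kappa_m1[of "Suc n"] by (simp add: t_def R_def S_def algebra_simps)
    hence 2: "?k (Suc n) (-1) = - ((-1) ^ n) * ?k (Suc n) 0 * S / R"
      using R by (simp add: field_simps)
    show ?thesis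
      unfolding 1 2 using R S nonint_nonzero[OF t] kappa_nonzero[OF B nonint]
      by (simp add: field_simps)
  qed
  moreover have "(- of_nat (Suc n) * (a - 1) + - of_nat n * a) - (- of_nat (Suc n) * a + - of_nat n * (a - 1)) = (1 :: complex)"
    by (simp add: algebra_simps)
  ultimately show ?thesis
    by (simp add: bessel_ratio_def [abs_def] t_def)
qed

text \<open>Of the four determinants in \<open>u n\<close>, only \<open>T (Suc n) (-1)\<close> has
  entered the strip where one factor $J_{a+m}$ contributes; the other three still have leading
  coefficient \<open>kappa\<close>. The limit of \<open>W n\<close> is read off
  \<open>quotient_plus\<close>, where every term except -2a tends to 0.\<close>

lemma ratio_leads_entry:
  assumes AB: "A \<noteq> 0" "B \<noteq> 0" and strip: "real n < Re a" "Re a < real n + 1"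
  shows "leads (u n) (- (A / B) * rGamma (a - of_nat n) * rGamma (1 - a) /
      (fact n * (rGamma (of_nat n + 1 - a))\<^sup>2)) (2 * a - 2 * of_nat n - 1)" (is ?th1)
    and "(W n \<longlongrightarrow> - 2 * a) (at 0 within slit_plane)" (is ?th2)
proof -
  let ?F = "at 0 within slit_plane :: complex filter"
  let ?k = "\<lambda>n m. kappa B a n m"
  define G where "G = rGamma_prod n a"
  define R where "R = rGamma (1 - a)"
  define S where "S = rGamma (of_nat n + 1 - a)"
  define e where "e = (1 - of_nat n) * (a - 1) - 2 * of_nat n"
  have R: "R \<noteq> 0" using nonint_reflect[OF nonint, of 1] rGamma_nonint by (simp add: R_def)
  have S: "S \<noteq> 0"
    using nonint_shift_nat(3)[OF nonint, of "Suc n"] rGamma_nonint by (simp add: S_def add.commute)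
  have Q: "rGamma (a - of_nat n) \<noteq> 0"
    using nonint_shift_nat(2)[OF nonint] rGamma_nonint by simp
  have G: "G \<noteq> 0" using rGamma_prod_nonzero[OF nonint] by (simp add: G_def)
  define l where "l = lambda A B a n (-1)"
  have l: "l = A * (-1) ^ n * B ^ n * G * rGamma (a - of_nat n)"
    by (simp add: l_def lambda_def G_def power_minus[of B])
  have L: "leads (T (Suc n) (-1)) l e"
    using tau_leads_pos[OF nonint AB(2), of n "-1" A] strip by (simp add: l_def e_def)
  have T0: "leads (T n 0) (?k n 0) (- of_nat n * a)"
    and Tm: "leads (T n (-1)) (?k n (-1)) (- of_nat n * (a - 1))"
    and S0: "leads (T (Suc n) 0) (?k (Suc n) 0) (- of_nat (Suc n) * a)"
    and T1: "leads (T n 1) (?k n 1) (- of_nat n * (a + 1))"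
    using tau_m1_0_leads[OF AB(2), of n] strip tau_leads_neg[OF nonint AB(2), of A n 1]
      tau_leads_neg[OF nonint AB(2), of A "Suc n" 0] by auto
  define K where "K = - 1 * (l * ?k n 0) / (?k (Suc n) 0 * ?k n (-1))"
  have "leads (\<lambda>x. - 1 * (T (Suc n) (-1) x * T n 0 x) / (T (Suc n) 0 x * T n (-1) x)) K
      ((e + - of_nat n * a) - (- of_nat (Suc n) * a + - of_nat n * (a - 1)))"
    unfolding K_def using kappa_nonzero[OF AB(2) nonint]
    by (intro leads_divide leads_cmult leads_mult L T0 S0 Tm) auto
  moreover have "(e + - of_nat n * a) - (- of_nat (Suc n) * a + - of_nat n * (a - 1)) = 2 * a - 2 * of_nat n - 1"
    by (simp add: e_def algebra_simps)
  ultimately have u: "leads (u n) K (2 * a - 2 * of_nat n - 1)"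
    by (simp add: bessel_ratio_def [abs_def])
  have k0: "?k n 0 = B ^ n * G" and k1: "?k (Suc n) 0 = B ^ n * G * (B * fact n * S)"
    by (simp_all add: kappa_def G_def S_def rGamma_prod_def add.commute)
  have km: "?k n (-1) = (-1) ^ n * (B ^ n * G) * S / R"
    using kappa_m1[of n] R unfolding k0 by (simp add: R_def S_def field_simps)
  have Keq: "K = - (A / B) * rGamma (a - of_nat n) * R / (fact n * S\<^sup>2)"
    unfolding K_def k0 k1 km l using G S R AB by (simp add: field_simps power2_eq_square)
  thus ?th1 using u by (simp add: R_def S_def)
  have K: "K \<noteq> 0" using Keq AB Q R S by simp
  \<comment> \<open>The exponent is 2(a - n), of positive real part by the lower bound of the strip.
    For \<open>x / u n x\<close> below it is 2(n + 1 - a), which uses the upper bound.\<close>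
  have "leads (\<lambda>x. x * (T (Suc n) (-1) x * T n 1 x / (T (Suc n) 0 x * T n 0 x))) 0 0"
    by (rule leads_higher[OF leads_mult[OF leads_id leads_divide[OF leads_mult[OF L T1] leads_mult[OF S0 T0]]]])
       (use strip kappa_nonzero[OF AB(2) nonint] in \<open>auto simp: e_def algebra_simps\<close>)
  moreover have "leads (\<lambda>x. x / u n x) 0 0"
    by (rule leads_higher[OF leads_divide[OF leads_id u K]]) (use strip in simp)
  ultimately have "((\<lambda>x. x * (T (Suc n) (-1) x * T n 1 x / (T (Suc n) 0 x * T n 0 x)) - x / u n x - 2 * a)
      \<longlongrightarrow> 0 - 0 - 2 * a) ?F"
    unfolding leads_0_iff by (intro tendsto_intros)
  moreover have "\<forall>\<^sub>F x in ?F. x * (T (Suc n) (-1) x * T n 1 x / (T (Suc n) 0 x * T n 0 x)) - x / u n x - 2 * a = W n x"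
    using eventually_slit_plane leads_nonzero[OF u K]
  proof eventually_elim
    case (elim x)
    show ?case unfolding quotient_plus[OF elim]
      using slit_plane_nonzero[OF elim(1)] by (simp add: ring_distribs)
  qed
  ultimately show ?th2
    using Lim_transform_eventually by fastforce
qed


lemma reflected_bessel_tau: "bessel_tau B (- A) (1 - a)"
  using nonint_reflect[OF nonint, of 1] nontrivial by unfold_locales auto

lemma leads_reflected:
  assumes "leads (bessel_ratio B (- A) (1 - a) n) K e" "K \<noteq> 0"
  shows "leads (u n) (- 1 / K) (- e)"
proof -
  have "u n = (\<lambda>x. - 1 / bessel_ratio B (- A) (1 - a) n x)"
    by (rule ext) (rule bessel_ratio_reflect)
  thus ?thesis
    using leads_divide[OF leads_const[of "-1"] assms] by simp
qed

lemma ratio_leads_left: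
  assumes "A \<noteq> 0" "B = 0 \<or> Re a < - real n"
  shows "leads (u n) (- (a + of_nat n)) (- 1)"
proof -
  interpret hat: bessel_tau B "- A" "1 - a" by (rule reflected_bessel_tau)
  have "a + of_nat n \<noteq> 0"
    using nonint_shift_nat(1)[OF nonint] nonint_nonzero by blast
  moreover have "leads (bessel_ratio B (- A) (1 - a) n) (1 / (a + of_nat n)) 1"
  proof -
    have "B = 0 \<or> Re (1 - a) > real n + 1" using assms(2) by auto
    from hat.ratio_leads_right[OF _ this] assms(1) show ?thesis by (simp add: add.commute)
  qed
  ultimately show ?thesis
    using leads_reflected[of n "1 / (a + of_nat n)" 1] by simp
qed

lemma ratio_leads_entry_left:
  assumes AB: "A \<noteq> 0" "B \<noteq> 0" and strip: "- real n < Re a" "Re a < 1 - real n"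
  shows "leads (u n) (- (A / B) * (fact n * (rGamma (a + of_nat n))\<^sup>2) /
      (rGamma (1 - a - of_nat n) * rGamma a)) (2 * a + 2 * of_nat n - 1)" (is ?th1)
    and "(W n \<longlongrightarrow> - 2 * (a + of_nat n)) (at 0 within slit_plane)" (is ?th2)
proof -
  let ?F = "at 0 within slit_plane :: complex filter"
  let ?v = "bessel_ratio B (- A) (1 - a) n" and ?V = "bessel_aux B (- A) (1 - a) n"
  interpret hat: bessel_tau B "- A" "1 - a" by (rule reflected_bessel_tau)
  define K where "K = (B / A) * rGamma (1 - a - of_nat n) * rGamma a /
      (fact n * (rGamma (a + of_nat n))\<^sup>2)"
  have nz: "rGamma (1 - a - of_nat n) \<noteq> 0" "rGamma a \<noteq> 0" "rGamma (a + of_nat n) \<noteq> 0"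
    using nonint_shift_nat(2)[OF hat.nonint, of n] nonint nonint_shift_nat(1)[OF nonint, of n]
    by (simp_all add: rGamma_nonint)
  have v: "leads ?v K (2 * (1 - a) - 2 * of_nat n - 1)"
    and V: "(?V \<longlongrightarrow> - 2 * (1 - a)) ?F"
    using hat.ratio_leads_entry[of n] AB strip by (simp_all add: K_def add.commute)
  have K: "K \<noteq> 0" using AB nz by (simp add: K_def)
  have "leads (u n) (- 1 / K) (- (2 * (1 - a) - 2 * of_nat n - 1))"
    by (rule leads_reflected[OF v K])
  moreover have "- 1 / K = - (A / B) * (fact n * (rGamma (a + of_nat n))\<^sup>2) /
      (rGamma (1 - a - of_nat n) * rGamma a)"
    using AB nz by (simp add: K_def)
  moreover have "- (2 * (1 - a) - 2 * of_nat n - 1) = 2 * a + 2 * of_nat n - 1"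
    by (simp add: algebra_simps)
  ultimately show ?th1 by (simp only:)
  have "((\<lambda>x. - (?V x + 2 * of_nat (Suc n))) \<longlongrightarrow> - (- 2 * (1 - a) + 2 * of_nat (Suc n))) ?F"
    by (intro tendsto_intros V)
  moreover have "\<forall>\<^sub>F x in ?F. - (?V x + 2 * of_nat (Suc n)) = W n x"
    using eventually_slit_plane leads_nonzero[OF v K]
    by eventually_elim (rule bessel_aux_reflect [symmetric], unfold_locales)
  ultimately have "(W n \<longlongrightarrow> - (- 2 * (1 - a) + 2 * of_nat (Suc n))) ?F"
    by (rule Lim_transform_eventually)
  thus ?th2 by (simp add: algebra_simps)
qed

text \<open>
  The constants of cases (2) and (3) of the theorem, with $n = i + j$ and $n = i + j + 1$ respectively. Both
  cases then live on the same strip $i - j < \mathrm{Re}\,a < i - j + 1$, on which the recursion in \<open>n\<close> alternates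
  between them.
\<close>

definition even_const :: "nat \<Rightarrow> nat \<Rightarrow> complex" where
  "even_const i j = (-1) ^ (i + j) * (- (A / B)) *
     (Gamma (of_int (int i - int j) - a + 1) / Gamma (a + of_int (int j - int i)))\<^sup>2 *
     ((Gamma (a + of_nat j) * fact j) / (Gamma (of_nat i - a + 1) * fact i))"

definition odd_const :: "nat \<Rightarrow> nat \<Rightarrow> complex" where
  "odd_const i j = (-1) ^ Suc (i + j) * inverse (- (A / B)) *
     (Gamma (a + of_int (int j - int i)) / Gamma (of_int (int i - int j) - a + 1))\<^sup>2 *
     ((Gamma (of_nat (Suc i) - a + 1) * fact i) / (Gamma (a + of_nat (Suc j)) * fact j))"

lemma Gamma_nonint: "z \<notin> \<int> \<Longrightarrow> Gamma (z :: complex) \<noteq> 0"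
  using not_in_Ints_imp_not_in_nonpos_Ints by (simp add: Gamma_eq_zero_iff)

lemma Gamma_shift_nonzero:
  "Gamma (a + of_int k) \<noteq> 0" "Gamma (of_int k - a + 1) \<noteq> 0"
  "Gamma (a + of_nat j) \<noteq> 0" "Gamma (of_nat j - a + 1) \<noteq> 0"
proof -
  show 1: "Gamma (a + of_int k) \<noteq> 0" for k
    using nonint_shift[OF nonint] Gamma_nonint by blast
  show 2: "Gamma (of_int k - a + 1) \<noteq> 0" for k
    using nonint_shift[OF nonint_reflect[OF nonint, of k], of 1] Gamma_nonint by simp
  show "Gamma (a + of_nat j) \<noteq> 0" "Gamma (of_nat j - a + 1) \<noteq> 0"
    using 1[of "int j"] 2[of "int j"] by simp_all
qed

lemma even_const_nonzero: "A \<noteq> 0 \<Longrightarrow> B \<noteq> 0 \<Longrightarrow> even_const i j \<noteq> 0"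
  using Gamma_shift_nonzero by (simp add: even_const_def del: of_int_diff)

lemma odd_const_nonzero: "A \<noteq> 0 \<Longrightarrow> B \<noteq> 0 \<Longrightarrow> odd_const i j \<noteq> 0"
  using Gamma_shift_nonzero unfolding odd_const_def
  by (simp del: of_nat_Suc of_int_diff)

text \<open>These match the limits of $u_n u_{n+1}$, namely (w + 2n + 2)/w with w = -2(a + j) at n =
  i + j and w = -2(i + 1) at n = i + j + 1, with denominators cleared.\<close>

lemma even_odd_const:
  assumes "A \<noteq> 0" "B \<noteq> 0"
  shows "even_const i j * odd_const i j * (a + of_nat j) = - (of_nat i - a + 1)"
    and "even_const (Suc i) (Suc j) * odd_const i j * of_nat (Suc i) = - of_nat (Suc j)"
proof -
  define P where "P = Gamma (of_int (int i - int j) - a + 1)"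
  define Q where "Q = Gamma (a + of_int (int j - int i))"
  define s where "s = ((-1) ^ (i + j) :: complex)"
  have s: "s * s = 1" "(-1) ^ Suc (i + j) = - s" "(-1) ^ (Suc i + Suc j) = s"
    by (simp_all add: s_def flip: power_mult_distrib)
  have PQ: "(P / Q)\<^sup>2 * (Q / P)\<^sup>2 = 1"
    using Gamma_shift_nonzero by (simp add: P_def Q_def power_divide del: of_int_diff)
  have G1: "Gamma (a + of_nat (Suc j)) = (a + of_nat j) * Gamma (a + of_nat j)"
    using Gamma_plus1[OF not_in_Ints_imp_not_in_nonpos_Ints[OF nonint_shift_nat(1)[OF nonint]], of j]
    by (simp add: add_ac)
  have "of_nat i - a + 1 \<notin> \<int>"
    using nonint_shift_nat(3)[OF nonint, of "Suc i"] by (simp add: algebra_simps)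
  from Gamma_plus1[OF not_in_Ints_imp_not_in_nonpos_Ints[OF this]]
  have G2: "Gamma (of_nat (Suc i) - a + 1) = (of_nat i - a + 1) * Gamma (of_nat i - a + 1)"
    by (simp add: algebra_simps)
  have "even_const i j * odd_const i j * (a + of_nat j) =
      - (s * s) * ((P / Q)\<^sup>2 * (Q / P)\<^sup>2) * (- (A / B) * inverse (- (A / B))) *
      ((Gamma (a + of_nat j) * fact j) / (Gamma (of_nat i - a + 1) * fact i) *
       ((Gamma (of_nat (Suc i) - a + 1) * fact i) / (Gamma (a + of_nat (Suc j)) * fact j)) * (a + of_nat j))"
    unfolding even_const_def odd_const_def s(2,3) P_def [symmetric] Q_def [symmetric] s_def [symmetric]
    by (simp only: mult_ac mult_minus_left mult_minus_right)
  also have "\<dots> = - ((Gamma (a + of_nat j) * fact j) / (Gamma (of_nat i - a + 1) * fact i) *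
       ((Gamma (of_nat (Suc i) - a + 1) * fact i) / (Gamma (a + of_nat (Suc j)) * fact j)) * (a + of_nat j))"
    unfolding PQ s using assms by simp
  also have "\<dots> = - (of_nat i - a + 1)"
    unfolding G1 G2 using Gamma_shift_nonzero(3)[of j] Gamma_shift_nonzero(4)[of i]
      nonint_nonzero[OF nonint_shift_nat(1)[OF nonint, of j]] by simp
  finally show "even_const i j * odd_const i j * (a + of_nat j) = - (of_nat i - a + 1)" .
  have diff: "int (Suc i) - int (Suc j) = int i - int j" "int (Suc j) - int (Suc i) = int j - int i"
    by simp_all
  have "even_const (Suc i) (Suc j) * odd_const i j * of_nat (Suc i) =
      - (s * s) * ((P / Q)\<^sup>2 * (Q / P)\<^sup>2) * (- (A / B) * inverse (- (A / B))) *
      ((Gamma (a + of_nat (Suc j)) * fact (Suc j)) / (Gamma (of_nat (Suc i) - a + 1) * fact (Suc i)) *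
       ((Gamma (of_nat (Suc i) - a + 1) * fact i) / (Gamma (a + of_nat (Suc j)) * fact j)) * of_nat (Suc i))"
    unfolding even_const_def odd_const_def s(2,3) diff P_def [symmetric] Q_def [symmetric]
    by (simp only: mult_ac mult_minus_left mult_minus_right)
  also have "\<dots> = - ((Gamma (a + of_nat (Suc j)) * fact (Suc j)) / (Gamma (of_nat (Suc i) - a + 1) * fact (Suc i)) *
       ((Gamma (of_nat (Suc i) - a + 1) * fact i) / (Gamma (a + of_nat (Suc j)) * fact j)) * of_nat (Suc i))"
    unfolding PQ s using assms by simp
  also have "\<dots> = - of_nat (Suc j)"
    using Gamma_shift_nonzero(3)[of "Suc j"] Gamma_shift_nonzero(4)[of "Suc i"]
    by (simp add: fact_Suc del: of_nat_Suc)
  finally show "even_const (Suc i) (Suc j) * odd_const i j * of_nat (Suc i) = - of_nat (Suc j)" .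
qed

text \<open>Identifies the constant of the theorem for j = 0 with the one found by
  \<open>ratio_leads_entry\<close>. \<open>rGamma_reflect_int\<close> rewrites one of the two
  factors $1/\<Gamma>(a - n)$ and absorbs the sign $(-1)^n$.\<close>

lemma even_const_right:
  "even_const n 0 = - (A / B) * rGamma (a - of_nat n) * rGamma (1 - a) /
      (fact n * (rGamma (of_nat n + 1 - a))\<^sup>2)"
proof -
  have "even_const n 0 = - (A / B) * ((-1) ^ n * (rGamma (a - of_nat n) * rGamma (a - of_nat n))) *
      (Gamma a * Gamma (of_nat n + 1 - a) / fact n)"
    using Gamma_shift_nonzero(4)[of n]
    by (simp add: even_const_def rGamma_inverse_Gamma power2_eq_square field_simps)
  also have "(-1) ^ n * (rGamma (a - of_nat n) * rGamma (a - of_nat n)) =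
      rGamma (a - of_nat n) * ((-1) ^ n * rGamma (a - of_nat n) * rGamma (of_nat n + 1 - a)) /
        rGamma (of_nat n + 1 - a)"
    using nonint_shift_nat(3)[OF nonint, of "Suc n"] rGamma_nonint by (simp add: add.commute)
  also have "(-1) ^ n * rGamma (a - of_nat n) * rGamma (of_nat n + 1 - a) = rGamma a * rGamma (1 - a)"
    by (rule rGamma_reflect_int)
  finally show ?thesis
    using Gamma_shift_nonzero(4)[of n] Gamma_shift_nonzero(3)[of 0]
    by (simp add: rGamma_inverse_Gamma power2_eq_square field_simps)
qed

lemma even_const_left:
  "even_const 0 n = - (A / B) * (fact n * (rGamma (a + of_nat n))\<^sup>2) /
      (rGamma (1 - a - of_nat n) * rGamma a)"
proof -
  define P where "P = Gamma (1 - a - of_nat n)"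
  define Q where "Q = Gamma (a + of_nat n)"
  have P: "P \<noteq> 0" and Q: "Q \<noteq> 0"
    using Gamma_shift_nonzero(2)[of "- int n"] Gamma_shift_nonzero(3)[of n]
    by (simp_all add: P_def Q_def algebra_simps)
  have G: "Gamma a \<noteq> 0" "Gamma (1 - a) \<noteq> 0"
    using Gamma_shift_nonzero(3)[of 0] Gamma_shift_nonzero(4)[of 0] by simp_all
  have "a + of_nat n - of_nat n = a" "of_nat n + 1 - (a + of_nat n) = 1 - a"
    "1 - (a + of_nat n) = 1 - a - of_nat n" by simp_all
  hence "(-1) ^ n * rGamma a * rGamma (1 - a) = rGamma (a + of_nat n) * rGamma (1 - a - of_nat n)"
    using rGamma_reflect_int[of n "a + of_nat n"] by (simp only:)
  hence "(-1) ^ n * inverse (Gamma a) * inverse (Gamma (1 - a)) = inverse Q * inverse P"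
    by (simp only: rGamma_inverse_Gamma P_def Q_def)
  hence refl: "(-1) ^ n / Gamma (1 - a) = Gamma a / (P * Q)"
    using P Q G by (simp add: field_simps)
  have "even_const 0 n = - (A / B) * (P / Q)\<^sup>2 * Q * fact n * ((-1) ^ n / Gamma (1 - a))"
    by (simp add: even_const_def P_def Q_def algebra_simps)
  also have "\<dots> = - (A / B) * (fact n * (1 / Q)\<^sup>2) * P * Gamma a"
    unfolding refl using P Q by (simp add: power2_eq_square field_simps)
  finally show ?thesis
    by (simp add: rGamma_inverse_Gamma P_def [symmetric] Q_def [symmetric] inverse_eq_divide)
qed

section \<open>Alternation of the two constants along a fixed strip\<close>

lemma quotient_eqI:
  fixes X Y E O' :: complex
  assumes "E * O' * Y = - X" "E \<noteq> 0" "Y \<noteq> 0"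
  shows "2 * X / (- 2 * Y * E) = O'"
proof -
  have "X = - (E * O' * Y)" using assms(1) by simp
  thus ?thesis using assms(2,3) by simp
qed

lemma ratio_leads_even_to_odd:
  assumes AB: "A \<noteq> 0" "B \<noteq> 0" and strip: "real i - real j < Re a" "Re a < real i - real j + 1"
    and u: "leads (u (i + j)) (even_const i j) (2 * a - 2 * of_nat i + 2 * of_nat j - 1)"
    and W: "(W (i + j) \<longlongrightarrow> - 2 * (a + of_nat j)) (at 0 within slit_plane)"
  shows "leads (u (Suc (i + j))) (odd_const i j) (- (2 * a - 2 * of_nat i + 2 * of_nat j - 1))"
    and "(W (Suc (i + j)) \<longlongrightarrow> - 2 * of_nat (Suc i)) (at 0 within slit_plane)"
proof -
  let ?w = "- 2 * (a + of_nat j)"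
  have w: "a + of_nat j \<noteq> 0" "of_nat i - a + 1 \<noteq> 0"
    using nonint_nonzero nonint_shift_nat(1)[OF nonint, of j] nonint_shift_nat(3)[OF nonint, of "Suc i"]
    by (auto simp: algebra_simps)
  have w2: "?w + 2 * of_nat (Suc (i + j)) = 2 * (of_nat i - a + 1)"
    by (simp add: algebra_simps)
  have nz: "?w \<noteq> 0" "?w + 2 * of_nat (Suc (i + j)) \<noteq> 0"
    unfolding w2 using w by (auto simp only: mult_eq_0_iff neg_equal_0_iff_equal numeral_neq_zero)
  have e: "- 1 < Re (2 * a - 2 * of_nat i + 2 * of_nat j - 1)" "Re (2 * a - 2 * of_nat i + 2 * of_nat j - 1) < 1"
    using strip by simp_all
  note step = ratio_leads_Suc[OF u even_const_nonzero[OF AB] e W nz]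
  have "(?w + 2 * of_nat (Suc (i + j))) / (?w * even_const i j) = odd_const i j"
    unfolding w2 using quotient_eqI[OF even_odd_const(1)[OF AB] even_const_nonzero[OF AB] w(1)] .
  thus "leads (u (Suc (i + j))) (odd_const i j) (- (2 * a - 2 * of_nat i + 2 * of_nat j - 1))"
    using step(1) by (simp only:)
  have "- ?w - 2 * a - 2 * of_nat (Suc (i + j)) = - 2 * of_nat (Suc i)"
    by (simp add: algebra_simps)
  moreover have "(W (Suc (i + j)) \<longlongrightarrow> - ?w - 2 * a - 2 * of_nat (Suc (i + j))) (at 0 within slit_plane)"
    by (rule step(2))
  ultimately show "(W (Suc (i + j)) \<longlongrightarrow> - 2 * of_nat (Suc i)) (at 0 within slit_plane)"
    by (simp only:)
qed

lemma ratio_leads_odd_to_even: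
  assumes AB: "A \<noteq> 0" "B \<noteq> 0" and strip: "real i - real j < Re a" "Re a < real i - real j + 1"
    and u: "leads (u (Suc (i + j))) (odd_const i j) (- (2 * a - 2 * of_nat i + 2 * of_nat j - 1))"
    and W: "(W (Suc (i + j)) \<longlongrightarrow> - 2 * of_nat (Suc i)) (at 0 within slit_plane)"
  shows "leads (u (Suc (Suc (i + j)))) (even_const (Suc i) (Suc j)) (2 * a - 2 * of_nat i + 2 * of_nat j - 1)"
    and "(W (Suc (Suc (i + j))) \<longlongrightarrow> - 2 * (a + of_nat (Suc j))) (at 0 within slit_plane)"
proof -
  let ?w = "- 2 * of_nat (Suc i) :: complex"
  have w2: "?w + 2 * of_nat (Suc (Suc (i + j))) = 2 * of_nat (Suc j)"
    by (simp add: algebra_simps)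
  have nz: "?w \<noteq> 0" "?w + 2 * of_nat (Suc (Suc (i + j))) \<noteq> 0"
    unfolding w2 by (simp_all del: of_nat_Suc)
  have e: "- 1 < Re (- (2 * a - 2 * of_nat i + 2 * of_nat j - 1))"
    "Re (- (2 * a - 2 * of_nat i + 2 * of_nat j - 1)) < 1"
    using strip by simp_all
  note step = ratio_leads_Suc[OF u odd_const_nonzero[OF AB] e W nz]
  have "(?w + 2 * of_nat (Suc (Suc (i + j)))) / (?w * odd_const i j) = even_const (Suc i) (Suc j)"
    unfolding w2 using even_odd_const(2)[OF AB, of i j] odd_const_nonzero[OF AB, of i j]
    by (intro quotient_eqI) (simp_all add: mult.commute del: of_nat_Suc)
  thus "leads (u (Suc (Suc (i + j)))) (even_const (Suc i) (Suc j)) (2 * a - 2 * of_nat i + 2 * of_nat j - 1)"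
    using step(1) by (simp only: minus_minus)
  have "- ?w - 2 * a - 2 * of_nat (Suc (Suc (i + j))) = - 2 * (a + of_nat (Suc j))"
    by (simp add: algebra_simps)
  moreover have "(W (Suc (Suc (i + j))) \<longlongrightarrow> - ?w - 2 * a - 2 * of_nat (Suc (Suc (i + j)))) (at 0 within slit_plane)"
    by (rule step(2))
  ultimately show "(W (Suc (Suc (i + j))) \<longlongrightarrow> - 2 * (a + of_nat (Suc j))) (at 0 within slit_plane)"
    by (simp only:)
qed

text \<open>The strip depends only on i - j, so the induction moves from (i, j) to (i + 1, j + 1) by
  two steps of the recursion. It starts at i = 0 from the reflected entry strip or at j = 0 from the
  direct one.\<close>

lemma ratio_leads_even:
  assumes AB: "A \<noteq> 0" "B \<noteq> 0" and "real i - real j < Re a" "Re a < real i - real j + 1"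
  shows "leads (u (i + j)) (even_const i j) (2 * a - 2 * of_nat i + 2 * of_nat j - 1) \<and>
    (W (i + j) \<longlongrightarrow> - 2 * (a + of_nat j)) (at 0 within slit_plane)"
  using assms(3,4)
proof (induction i arbitrary: j)
  case 0
  thus ?case
    using ratio_leads_entry_left[OF AB, of j] by (simp add: even_const_left)
next
  case (Suc i)
  show ?case
  proof (cases j)
    case 0
    thus ?thesis
      using ratio_leads_entry[OF AB, of "Suc i"] Suc.prems
      by (simp add: 0 even_const_right del: of_nat_Suc)
  next
    case (Suc j')
    have strip: "real i - real j' < Re a" "Re a < real i - real j' + 1"
      using Suc.prems Suc by simp_all
    from Suc.IH[OF strip]
    have IH: "leads (u (i + j')) (even_const i j') (2 * a - 2 * of_nat i + 2 * of_nat j' - 1)"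
      "(W (i + j') \<longlongrightarrow> - 2 * (a + of_nat j')) (at 0 within slit_plane)" by blast+
    note odd = ratio_leads_even_to_odd[OF AB strip IH]
    have "2 * a - 2 * of_nat (Suc i) + 2 * of_nat (Suc j') - 1 = 2 * a - 2 * of_nat i + 2 * of_nat j' - 1"
      and "Suc i + Suc j' = Suc (Suc (i + j'))" by simp_all
    thus ?thesis
      using ratio_leads_odd_to_even[OF AB strip odd] by (simp only: Suc simp_thms)
  qed
qed

lemma ratio_leads_odd:
  assumes AB: "A \<noteq> 0" "B \<noteq> 0" and strip: "real i - real j < Re a" "Re a < real i - real j + 1"
  shows "leads (u (Suc (i + j))) (odd_const i j) (- (2 * a - 2 * of_nat i + 2 * of_nat j - 1))"
  using ratio_leads_even_to_odd(1)[OF assms] ratio_leads_even[OF assms] by blast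

end

section \<open>The four cases\<close>

lemma Bessel_Delta_conv:
  assumes S: "sin (of_real pi * a) \<noteq> (0 :: complex)"
  shows "Bessel_Delta d1 d2 n x (2 * (a + of_int m)) =
    tau ((d1 * sin (of_real pi * a) + d2 * cos (of_real pi * a)) / sin (of_real pi * a))
      (- d2 / sin (of_real pi * a)) a n m x"
proof -
  have "2 * (a + of_int m) / 2 - of_nat j + of_nat k = a + of_int (m - int j + int k)" for j k
    by (simp add: add_diff_eq add.assoc)
  thus ?thesis
    by (simp only: Bessel_Delta_def tau_def fdet_def Bessel_C_conv[OF S])
qed

lemma Bessel_u_conv:
  assumes S: "sin (of_real pi * a) \<noteq> (0 :: complex)"
  shows "Bessel_u d1 d2 n (2 * a) =
    bessel_ratio ((d1 * sin (of_real pi * a) + d2 * cos (of_real pi * a)) / sin (of_real pi * a))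
      (- d2 / sin (of_real pi * a)) a n"
proof
  fix x
  have "2 * a - 2 = 2 * (a + of_int (-1))" "2 * a = 2 * (a + of_int 0)" by simp_all
  thus "Bessel_u d1 d2 n (2 * a) x =
    bessel_ratio ((d1 * sin (of_real pi * a) + d2 * cos (of_real pi * a)) / sin (of_real pi * a))
      (- d2 / sin (of_real pi * a)) a n x"
    unfolding Bessel_u_def bessel_ratio_def
    by (simp only: Bessel_Delta_conv[OF S] Suc_eq_plus1)
qed

context bessel_tau
begin

lemma ratio_asymp_even:
  assumes AB: "A \<noteq> 0" "B \<noteq> 0" and j: "j \<le> n"
    and strip: "2 * real n - 4 * real j < Re (2 * a)" "Re (2 * a) < 2 * real n - 4 * real j + 2"
  shows "u n \<sim>[at 0 within slit_plane] (\<lambda>x. (-1) ^ n * (- (A / B)) *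
    (Gamma (- (2 * a) / 2 + of_nat n - 2 * of_nat j + 1) / Gamma (2 * a / 2 - of_nat n + 2 * of_nat j))\<^sup>2 *
    ((Gamma (of_nat j + 2 * a / 2) * Gamma (of_nat j + 1)) /
      (Gamma (- (2 * a) / 2 + of_nat n - of_nat j + 1) * Gamma (of_nat n - of_nat j + 1))) *
    (x / 2) powr (2 * a - 2 * of_nat n + 4 * of_nat j - 1))"
proof -
  define i where "i = n - j"
  have n: "n = i + j" using j by (simp add: i_def)
  have args: "- (2 * a) / 2 + of_nat n - 2 * of_nat j + 1 = of_int (int i - int j) - a + 1"
    "2 * a / 2 - of_nat n + 2 * of_nat j = a + of_int (int j - int i)"
    "of_nat j + 2 * a / 2 = a + of_nat j" "(of_nat j :: complex) + 1 = 1 + of_nat j"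
    "- (2 * a) / 2 + of_nat n - of_nat j + 1 = of_nat i - a + 1"
    "(of_nat n :: complex) - of_nat j + 1 = 1 + of_nat i"
    "2 * a - 2 * of_nat n + 4 * of_nat j - 1 = 2 * a - 2 * of_nat i + 2 * of_nat j - 1"
    by (simp_all add: n)
  have "leads (u n) (even_const i j) (2 * a - 2 * of_nat i + 2 * of_nat j - 1)"
    using ratio_leads_even[OF AB, of i j] strip by (simp add: n)
  from leads_imp_asymp_equiv[OF this even_const_nonzero[OF AB]]
  show ?thesis
    unfolding args Gamma_fact unfolding even_const_def n .
qed

lemma ratio_asymp_odd:
  assumes AB: "A \<noteq> 0" "B \<noteq> 0" and j: "j < n"
    and strip: "2 * real n - 4 * real j - 2 < Re (2 * a)" "Re (2 * a) < 2 * real n - 4 * real j"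
  shows "u n \<sim>[at 0 within slit_plane] (\<lambda>x. (-1) ^ n * inverse (- (A / B)) *
    (Gamma (2 * a / 2 - of_nat n + 2 * of_nat j + 1) / Gamma (- (2 * a) / 2 + of_nat n - 2 * of_nat j))\<^sup>2 *
    ((Gamma (- (2 * a) / 2 + of_nat n - of_nat j + 1) * Gamma (of_nat n - of_nat j)) /
      (Gamma (of_nat j + 2 * a / 2 + 1) * Gamma (of_nat j + 1))) *
    (x / 2) powr (- (2 * a) + 2 * of_nat n - 4 * of_nat j - 1))"
proof -
  define i where "i = n - Suc j"
  have n: "n = Suc (i + j)" using j by (simp add: i_def)
  have args: "2 * a / 2 - of_nat n + 2 * of_nat j + 1 = a + of_int (int j - int i)"
    "- (2 * a) / 2 + of_nat n - 2 * of_nat j = of_int (int i - int j) - a + 1"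
    "- (2 * a) / 2 + of_nat n - of_nat j + 1 = of_nat (Suc i) - a + 1"
    "(of_nat n :: complex) - of_nat j = 1 + of_nat i"
    "of_nat j + 2 * a / 2 + 1 = a + of_nat (Suc j)" "(of_nat j :: complex) + 1 = 1 + of_nat j"
    "- (2 * a) + 2 * of_nat n - 4 * of_nat j - 1 = - (2 * a - 2 * of_nat i + 2 * of_nat j - 1)"
    by (simp_all add: n)
  have "leads (u n) (odd_const i j) (- (2 * a - 2 * of_nat i + 2 * of_nat j - 1))"
    using ratio_leads_odd[OF AB, of i j] strip by (simp add: n)
  from leads_imp_asymp_equiv[OF this odd_const_nonzero[OF AB]]
  show ?thesis
    unfolding args Gamma_fact unfolding odd_const_def n .
qed

lemma ratio_asymp_right:
  assumes "B \<noteq> 0" "A = 0 \<or> Re (2 * a) > 2 * real n + 2"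
  shows "u n \<sim>[at 0 within slit_plane] (\<lambda>x. 2 / (2 * of_nat n + 2 - 2 * a) * (x / 2))"
proof -
  have nz: "of_nat n + 1 - a \<noteq> 0"
    using nonint_nonzero[OF nonint_shift_nat(3)[OF nonint, of "Suc n"]] by (simp add: add.commute)
  have "2 / (2 * of_nat n + 2 - 2 * a) = 2 / (2 * (of_nat n + 1 - a))"
    by (simp add: algebra_simps)
  also have "2 / (2 * t) = 1 / t" for t :: complex by simp
  finally have eq: "2 / (2 * of_nat n + 2 - 2 * a) = 1 / (of_nat n + 1 - a)" .
  have "A = 0 \<or> Re a > real n + 1" using assms(2) by auto
  from leads_imp_asymp_equiv[OF ratio_leads_right[OF assms(1) this]] nz show ?thesis
    unfolding eq by simp
qed

lemma ratio_asymp_left: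
  assumes "A \<noteq> 0" "B = 0 \<or> Re (2 * a) < - 2 * real n"
  shows "u n \<sim>[at 0 within slit_plane] (\<lambda>x. (- (2 * a) / 2 - of_nat n) * inverse (x / 2))"
proof -
  have nz: "- (a + of_nat n) \<noteq> 0"
    unfolding neg_equal_0_iff_equal by (rule nonint_nonzero[OF nonint_shift_nat(1)[OF nonint]])
  have eq: "- (2 * a) / 2 - of_nat n = - (a + of_nat n)" by simp
  have powr: "(x / 2) powr - 1 = inverse (x / 2)" for x :: complex
    by (simp add: powr_minus)
  have "B = 0 \<or> Re a < - real n" using assms(2) by auto
  from leads_imp_asymp_equiv[OF ratio_leads_left[OF assms(1) this] nz] show ?thesis
    unfolding eq powr .
qed

end

theorem theorem1p2:
  fixes d1 d2 \<alpha> :: complex and n :: nat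
  assumes alpha: "\<And>m::int. \<alpha> \<noteq> 2 * of_int m"
  shows
    "let u = Bessel_u d1 d2 n \<alpha>;
         S = sin (of_real pi * \<alpha> / 2);
         C = cos (of_real pi * \<alpha> / 2);
         F = at 0 within slit_plane
     in
       solves_Painleve_III (\<alpha> + 2 * of_nat n) (- \<alpha> + 2 + 2 * of_nat n) u slit_plane \<and>
       (d2 \<noteq> 0 \<and> (Re \<alpha> > 2 * real n + 2 \<or> d1 * S + d2 * C = 0) \<longrightarrow>
          u \<sim>[F] (\<lambda>x. 2 / (2 * of_nat n + 2 - \<alpha>) * (x / 2))) \<and>
       (\<forall>j\<in>{0..n}. d2 \<noteq> 0 \<and> d1 * S + d2 * C \<noteq> 0 \<and>
          2 * real n - 4 * real j < Re \<alpha> \<and> Re \<alpha> < 2 * real n - 4 * real j + 2 \<longrightarrow>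
          u \<sim>[F] (\<lambda>x. (-1) ^ n * (d1 / d2 * S + C) *
            (Gamma (- \<alpha> / 2 + of_nat n - 2 * of_nat j + 1) /
               Gamma (\<alpha> / 2 - of_nat n + 2 * of_nat j))\<^sup>2 *
            ((Gamma (of_nat j + \<alpha> / 2) * Gamma (of_nat j + 1)) /
               (Gamma (- \<alpha> / 2 + of_nat n - of_nat j + 1) * Gamma (of_nat n - of_nat j + 1))) *
            (x / 2) powr (\<alpha> - 2 * of_nat n + 4 * of_nat j - 1))) \<and>
       (\<forall>j\<in>{0..<n}. d2 \<noteq> 0 \<and> d1 * S + d2 * C \<noteq> 0 \<and>
          2 * real n - 4 * real j - 2 < Re \<alpha> \<and> Re \<alpha> < 2 * real n - 4 * real j \<longrightarrow>
          u \<sim>[F] (\<lambda>x. (-1) ^ n * inverse (d1 / d2 * S + C) *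
            (Gamma (\<alpha> / 2 - of_nat n + 2 * of_nat j + 1) /
               Gamma (- \<alpha> / 2 + of_nat n - 2 * of_nat j))\<^sup>2 *
            ((Gamma (- \<alpha> / 2 + of_nat n - of_nat j + 1) * Gamma (of_nat n - of_nat j)) /
               (Gamma (of_nat j + \<alpha> / 2 + 1) * Gamma (of_nat j + 1))) *
            (x / 2) powr (- \<alpha> + 2 * of_nat n - 4 * of_nat j - 1))) \<and>
       (d1 * S + d2 * C \<noteq> 0 \<and> (Re \<alpha> < - 2 * real n \<or> d2 = 0) \<longrightarrow>
          u \<sim>[F] (\<lambda>x. (- \<alpha> / 2 - of_nat n) * inverse (x / 2)))"
proof -
  define a where "a = \<alpha> / 2"
  define S where "S = sin (of_real pi * a)"
  define C where "C = cos (of_real pi * a)"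
  define A where "A = (d1 * S + d2 * C) / S"
  define B where "B = - d2 / S"
  have alpha_eq: "\<alpha> = 2 * a" by (simp add: a_def)
  have SC: "sin (of_real pi * (2 * a) / 2) = S" "cos (of_real pi * (2 * a) / 2) = C"
    by (simp_all add: S_def C_def)
  have a: "a \<notin> \<int>"
    using alpha by (auto simp: alpha_eq elim!: Ints_cases)
  have S: "S \<noteq> 0"
  proof
    assume "S = 0"
    then obtain m :: int where "of_real pi * a = of_real (of_int m * pi)"
      unfolding S_def sin_eq_0 by auto
    hence "a = of_int m" by simp
    thus False using a by simp
  qed
  have u: "Bessel_u d1 d2 n (2 * a) = bessel_ratio A B a n"
    unfolding A_def B_def S_def C_def by (rule Bessel_u_conv) (use S in \<open>simp add: S_def\<close>)
  have A0: "A = 0 \<longleftrightarrow> d1 * S + d2 * C = 0" and B0: "B = 0 \<longleftrightarrow> d2 = 0"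
    using S by (simp_all add: A_def B_def)
  have quotient: "d1 / d2 * S + C = - (A / B)" if "d2 \<noteq> 0"
    using that S by (simp add: A_def B_def field_simps)
  show ?thesis
  \<comment> \<open>If both constants vanish, the locale does not apply: \<open>u\<close> is then
    identically 0 by the convention for division, the condition of
    \<open>solves_Painleve_III\<close> is vacuous, and the hypotheses of all four cases
    fail.\<close>
  proof (cases "d1 = 0 \<and> d2 = 0")
    case True
    hence "bessel_seq A B a m x = 0" for m x
      by (simp add: A_def B_def bessel_seq_def)
    hence "tau A B a (Suc n) m x = 0" for m x
      unfolding tau_def by (subst fdet_expand_singleton_column[where k = 0 and l = 0]) auto
    hence "bessel_ratio A B a n x = 0" for x
      by (simp add: bessel_ratio_def)
    thus ?thesis
      using True unfolding Let_def alpha_eq u by (simp add: solves_Painleve_III_def)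
  next
    case False
    interpret bessel_tau A B a
    proof
      show "A \<noteq> 0 \<or> B \<noteq> 0" using False S by (auto simp: A_def B_def)
    qed (rule a)
    show ?thesis
      unfolding Let_def alpha_eq u SC
    proof (intro conjI ballI impI)
      show "solves_Painleve_III (2 * a + 2 * of_nat n) (- (2 * a) + 2 + 2 * of_nat n) (u n) slit_plane"
        using bessel_ratio_Painleve_III by simp
    next
      assume "d2 \<noteq> 0 \<and> (Re (2 * a) > 2 * real n + 2 \<or> d1 * S + d2 * C = 0)"
      thus "u n \<sim>[at 0 within slit_plane] (\<lambda>x. 2 / (2 * of_nat n + 2 - 2 * a) * (x / 2))"
        by (intro ratio_asymp_right) (auto simp: A0 B0)
    next
      fix j assume j: "j \<in> {0..n}" and *: "d2 \<noteq> 0 \<and> d1 * S + d2 * C \<noteq> 0 \<and>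
          2 * real n - 4 * real j < Re (2 * a) \<and> Re (2 * a) < 2 * real n - 4 * real j + 2"
      hence "d2 \<noteq> 0" by blast
      show "u n \<sim>[at 0 within slit_plane] (\<lambda>x. (-1) ^ n * (d1 / d2 * S + C) *
            (Gamma (- (2 * a) / 2 + of_nat n - 2 * of_nat j + 1) /
               Gamma (2 * a / 2 - of_nat n + 2 * of_nat j))\<^sup>2 *
            ((Gamma (of_nat j + 2 * a / 2) * Gamma (of_nat j + 1)) /
               (Gamma (- (2 * a) / 2 + of_nat n - of_nat j + 1) * Gamma (of_nat n - of_nat j + 1))) *
            (x / 2) powr (2 * a - 2 * of_nat n + 4 * of_nat j - 1))"
        unfolding quotient[OF \<open>d2 \<noteq> 0\<close>] by (rule ratio_asymp_even) (use j * A0 B0 in auto)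
    next
      fix j assume j: "j \<in> {0..<n}" and *: "d2 \<noteq> 0 \<and> d1 * S + d2 * C \<noteq> 0 \<and>
          2 * real n - 4 * real j - 2 < Re (2 * a) \<and> Re (2 * a) < 2 * real n - 4 * real j"
      hence "d2 \<noteq> 0" by blast
      show "u n \<sim>[at 0 within slit_plane] (\<lambda>x. (-1) ^ n * inverse (d1 / d2 * S + C) *
            (Gamma (2 * a / 2 - of_nat n + 2 * of_nat j + 1) /
               Gamma (- (2 * a) / 2 + of_nat n - 2 * of_nat j))\<^sup>2 *
            ((Gamma (- (2 * a) / 2 + of_nat n - of_nat j + 1) * Gamma (of_nat n - of_nat j)) /
               (Gamma (of_nat j + 2 * a / 2 + 1) * Gamma (of_nat j + 1))) *
            (x / 2) powr (- (2 * a) + 2 * of_nat n - 4 * of_nat j - 1))"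
        unfolding quotient[OF \<open>d2 \<noteq> 0\<close>] by (rule ratio_asymp_odd) (use j * A0 B0 in auto)
    next
      assume "d1 * S + d2 * C \<noteq> 0 \<and> (Re (2 * a) < - 2 * real n \<or> d2 = 0)"
      thus "u n \<sim>[at 0 within slit_plane] (\<lambda>x. (- (2 * a) / 2 - of_nat n) * inverse (x / 2))"
        by (intro ratio_asymp_left) (auto simp: A0 B0)
    qed
  qed
qed

end
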